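(* Let $k\in\mathbb Z^d$ and $\omega\in\mathbb R$ satisfy $\omega+\frac{|k|^2}{2}=\gamma^2\kappa\langle\sigma_1\rangle^2$, and assume $4\gamma^2\kappa\|\sigma_1\|_{L^1(\mathbb T^d)}^2<1$. Then the plane wave $u_\omega(t,x)=e^{i\omega t}$ is orbitally stable for the equation $$i\partial_tu+\tfrac12\Delta u-\tfrac{|k|^2}{2}u+ik\cdot\nabla u=-\gamma^2\kappa(\Sigma\star|u|^2)u\quad\text{on }\mathbb T^d,$$ i.e. for every $\varepsilon>0$ there is $\delta>0$ such that for every $v^{\mathrm{Init}}\in H^1(\mathbb T^d;\mathbb C)$ with $\|v^{\mathrm{Init}}-\mathbf 1\|_{H^1}<\delta$, the solution $v\in C^0([0,\infty);H^1(\mathbb T^d))$ with $v(0)=v^{\mathrm{Init}}$ satisfies $\sup_{t\ge0}\inf_{\theta\in[0,2\pi)}\|v(t)-e^{i\theta}\mathbf 1\|_{H^1}<\varepsilon$.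
   Context: Let $d\ge1$, $n\ge3$, $\mathbb T^d=(\mathbb R/2\pi\mathbb Z)^d$. $\sigma_1:\mathbb T^d\to[0,\infty)$ is $C^\infty$, radially symmetric, $\langle\sigma_1\rangle:=\int_{\mathbb T^d}\sigma_1\neq0$; $\sigma_2:\mathbb R^n\to[0,\infty)$ is $C^\infty$, radially symmetric, compactly supported, $(-\Delta)^{-1/2}\sigma_2\in L^2(\mathbb R^n)$, $\widehat\sigma_2(\xi)\ne0$ for all $\xi$; $\kappa=\int\frac{|\widehat\sigma_2(\xi)|^2}{|\xi|^2}\frac{d\xi}{(2\pi)^n}$ with $\widehat\varphi(\xi)=\int\varphi(z)e^{-i\xi\cdot z}dz$; $\Sigma=\sigma_1\star\sigma_1$; $\gamma>0$; $\mathbf 1$ is the constant function $1$. It is assumed that the equation is globally well posed in $H^1(\mathbb T^d)$ with conservation of $\|u\|_{L^2}$, of the momenta $\int\frac1i\partial_{x_j}u\,\bar u$ and of the energy $\frac12\big(\frac12\int|\nabla u|^2+\frac{|k|^2}{2}\int|u|^2+\int k\cdot(-i\nabla u)\bar u\big)-\frac{\gamma^2\kappa}{4}\int(\Sigma\star|u|^2)|u|^2$. *)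

theory Defs
  imports "HOL-Analysis.Analysis"
begin

fun iter_partial :: "'a::finite list \<Rightarrow> (real^'a \<Rightarrow> real) \<Rightarrow> (real^'a \<Rightarrow> real)" where
  "iter_partial [] f = f"
| "iter_partial (i # is) f = (\<lambda>x. deriv (\<lambda>t. iter_partial is f (x + t *\<^sub>R axis i 1)) 0)"

definition smooth_fun :: "(real^'a::finite \<Rightarrow> real) \<Rightarrow> bool" where
  "smooth_fun f \<longleftrightarrow> (\<forall>is x. iter_partial is f differentiable (at x))"

definition cube :: "(real^'d::finite) set" where
  "cube = {x. \<forall>i. 0 \<le> x$i \<and> x$i \<le> 2*pi}"

definition periodic_torus :: "(real^'d::finite \<Rightarrow> 'b) \<Rightarrow> bool" where
  "periodic_torus f \<longleftrightarrow> (\<forall>x i. f (x + (2*pi) *\<^sub>R axis i 1) = f x)"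

text \<open>Radial symmetry on the torus: f depends only on the Euclidean norm of the
  representative in the centred cube [-pi,pi]^d.\<close>
definition radial_torus :: "(real^'d::finite \<Rightarrow> real) \<Rightarrow> bool" where
  "radial_torus f \<longleftrightarrow> (\<forall>x y. (\<forall>i. \<bar>x$i\<bar> \<le> pi) \<longrightarrow> (\<forall>i. \<bar>y$i\<bar> \<le> pi) \<longrightarrow>
      norm x = norm y \<longrightarrow> f x = f y)"

definition torus_int :: "(real^'d::finite \<Rightarrow> 'b::{banach,second_countable_topology}) \<Rightarrow> 'b" where
  "torus_int f = integral\<^sup>L (lebesgue_on cube) f"

definition torus_conv :: "(real^'d::finite \<Rightarrow> real) \<Rightarrow> (real^'d \<Rightarrow> real) \<Rightarrow> real^'d \<Rightarrow> real" where
  "torus_conv f g x = torus_int (\<lambda>y. f (x - y) * g y)"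

definition ivec_sq :: "int^'d::finite \<Rightarrow> int" where
  "ivec_sq m = (\<Sum>i\<in>UNIV. (m$i)^2)"

definition ivec_dot :: "int^'d::finite \<Rightarrow> int^'d \<Rightarrow> int" where
  "ivec_dot k m = (\<Sum>i\<in>UNIV. k$i * m$i)"

definition fcoeff :: "(real^'d::finite \<Rightarrow> complex) \<Rightarrow> int^'d \<Rightarrow> complex" where
  "fcoeff f m = torus_int (\<lambda>x. f x * cis (- (\<Sum>i\<in>UNIV. of_int (m$i) * x$i)))"

definition in_H1 :: "(real^'d::finite \<Rightarrow> complex) \<Rightarrow> bool" where
  "in_H1 f \<longleftrightarrow> f \<in> borel_measurable (lebesgue_on cube)
     \<and> integrable (lebesgue_on cube) (\<lambda>x. (cmod (f x))^2)
     \<and> (\<lambda>m. (1 + of_int (ivec_sq m)) * (cmod (fcoeff f m))^2) summable_on (UNIV :: (int^'d) set)"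

text \<open>||f||_{H^1}^2 = ||f||_{L^2}^2 + ||grad f||_{L^2}^2, expressed by Parseval.\<close>
definition H1_norm :: "(real^'d::finite \<Rightarrow> complex) \<Rightarrow> real" where
  "H1_norm f = sqrt ((\<Sum>\<^sub>\<infinity>m\<in>(UNIV :: (int^'d) set).
       (1 + of_int (ivec_sq m)) * (cmod (fcoeff f m))^2) / (2*pi)^CARD('d))"

definition mass :: "(real^'d::finite \<Rightarrow> complex) \<Rightarrow> real" where
  "mass u = torus_int (\<lambda>x. (cmod (u x))^2)"

text \<open>Momentum: int (1/i) d_j u conj(u) = (2pi)^{-d} sum_m m_j |u_m|^2 (Parseval).\<close>
definition momentum :: "(real^'d::finite \<Rightarrow> complex) \<Rightarrow> 'd \<Rightarrow> real" where
  "momentum u j = (\<Sum>\<^sub>\<infinity>m\<in>(UNIV :: (int^'d) set). of_int (m$j) * (cmod (fcoeff u m))^2)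
                   / (2*pi)^CARD('d)"

text \<open>Dirichlet term: int |grad u|^2 = (2pi)^{-d} sum_m |m|^2 |u_m|^2 (Parseval).\<close>
definition dirichlet :: "(real^'d::finite \<Rightarrow> complex) \<Rightarrow> real" where
  "dirichlet u = (\<Sum>\<^sub>\<infinity>m\<in>(UNIV :: (int^'d) set). of_int (ivec_sq m) * (cmod (fcoeff u m))^2)
                   / (2*pi)^CARD('d)"

definition Sigma :: "(real^'d::finite \<Rightarrow> real) \<Rightarrow> real^'d \<Rightarrow> real" where
  "Sigma \<sigma>1 = torus_conv \<sigma>1 \<sigma>1"

definition potential :: "(real^'d::finite \<Rightarrow> real) \<Rightarrow> (real^'d \<Rightarrow> complex) \<Rightarrow> real^'d \<Rightarrow> real" where
  "potential \<sigma>1 u = torus_conv (Sigma \<sigma>1) (\<lambda>y. (cmod (u y))^2)"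

definition energy :: "(real^'d::finite \<Rightarrow> real) \<Rightarrow> real \<Rightarrow> real \<Rightarrow> int^'d \<Rightarrow>
     (real^'d \<Rightarrow> complex) \<Rightarrow> real" where
  "energy \<sigma>1 \<gamma> \<kappa> k u =
     (1/2) * ((1/2) * dirichlet u + (of_int (ivec_sq k) / 2) * mass u
              + (\<Sum>j\<in>UNIV. of_int (k$j) * momentum u j))
     - (\<gamma>^2 * \<kappa> / 4) * torus_int (\<lambda>x. potential \<sigma>1 u x * (cmod (u x))^2)"

text \<open>Solution of
  i u_t + 1/2 Lap u - |k|^2/2 u + i k.grad u = - gamma^2 kappa (Sigma * |u|^2) u,
  taken in the Fourier (mild) sense: continuity into H^1 and, for each mode m,
  the Fourier coefficient is differentiable in t and satisfies the projected equation.\<close>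
definition is_solution :: "(real^'d::finite \<Rightarrow> real) \<Rightarrow> real \<Rightarrow> real \<Rightarrow> int^'d \<Rightarrow>
     (real \<Rightarrow> real^'d \<Rightarrow> complex) \<Rightarrow> bool" where
  "is_solution \<sigma>1 \<gamma> \<kappa> k v \<longleftrightarrow>
     (\<forall>t\<ge>0. in_H1 (v t))
   \<and> (\<forall>t\<ge>0. ((\<lambda>s. H1_norm (\<lambda>x. v s x - v t x)) \<longlongrightarrow> 0) (at t within {0..}))
   \<and> (\<forall>t\<ge>0. \<forall>m. \<exists>D. ((\<lambda>s. fcoeff (v s) m) has_vector_derivative D) (at t within {0..})
        \<and> \<i> * D - (of_int (ivec_sq m) / 2) * fcoeff (v t) m
            - (of_int (ivec_sq k) / 2) * fcoeff (v t) m
            + \<i> * (\<i> * of_int (ivec_dot k m)) * fcoeff (v t) m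
          = - complex_of_real (\<gamma>^2 * \<kappa>)
              * fcoeff (\<lambda>x. complex_of_real (potential \<sigma>1 (v t) x) * v t x) m)"

definition fourier_Rn :: "(real^'n::finite \<Rightarrow> real) \<Rightarrow> real^'n \<Rightarrow> complex" where
  "fourier_Rn \<phi> \<xi> = (LINT z|lborel. complex_of_real (\<phi> z) * cis (- (\<xi> \<bullet> z)))"

definition kappa_of :: "(real^'n::finite \<Rightarrow> real) \<Rightarrow> real" where
  "kappa_of \<sigma>2 = (LINT \<xi>|lborel. (cmod (fourier_Rn \<sigma>2 \<xi>))^2 / (norm \<xi>)^2) / (2*pi)^CARD('n)"

end

theory Submission
  imports Defs
begin

text \<open>
Conservation of mass, momentum and energy makes \<open>D(u) - \<gamma>\<^sup>2 \<kappa> \<integral> (\<Sigma> \<star> |u|\<^sup>2) |u|\<^sup>2\<close>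
a constant of motion, where \<open>D(u) = \<integral> |\<nabla>u|\<^sup>2\<close>. Write \<open>u = c + w\<close> with \<open>c\<close> the mean of \<open>u\<close>;
then \<open>|u|\<^sup>2\<close> is its mean plus \<open>2 Re (cnj c w)\<close> plus a quadratic remainder. The mean only contributes a
function of the conserved mass. As \<open>\<integral> \<Sigma> = \<langle>\<sigma>\<^sub>1\<rangle>\<^sup>2\<close>, Schur's test bounds the contribution of the linear
part by \<open>4 \<langle>\<sigma>\<^sub>1\<rangle>\<^sup>2 |c|\<^sup>2 \<parallel>w\<parallel>\<^sup>2\<close>, and the rest is \<open>O(\<parallel>w\<parallel>\<^sup>3)\<close> in every dimension because \<open>\<Sigma>\<close> is
bounded (no Sobolev embedding is needed). The Poincare inequality \<open>\<parallel>w\<parallel>\<^sup>2 \<le> D(u)\<close> and the smallness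
condition then make the constant of motion coercive as long as \<open>\<parallel>w\<parallel>\<close> is small. Since
\<open>\<parallel>w\<parallel>\<^sup>2\<close> is the mass minus the zero Fourier mode, it is continuous in time, so it never leaves the
small range, and \<open>|c|\<close> is recovered from the mass.

The Poincare inequality requires completeness of the characters in \<open>L\<^sup>2\<close> of the torus, which
follows from Stone-Weierstrass on the image of the cube under \<open>x \<mapsto> (cis x\<^sub>i)\<^sub>i\<close>. Invariance of
the integral of a periodic function under translation and reflection is obtained by the same
approximation.
\<close>

section \<open>Trigonometric polynomials\<close>

definition torus_exp :: "int^'d \<Rightarrow> real^'d::finite \<Rightarrow> complex" where
  "torus_exp m x = cis (\<Sum>i\<in>UNIV. of_int (m$i) * x$i)"

lemma torus_exp_0 [simp]: "torus_exp 0 x = 1"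
  by (simp add: torus_exp_def)

lemma torus_exp_add: "torus_exp (m + n) x = torus_exp m x * torus_exp n x"
  by (simp add: torus_exp_def cis_mult sum.distrib algebra_simps)

lemma torus_exp_translate: "torus_exp m (x + y) = torus_exp m x * torus_exp m y"
  by (simp add: torus_exp_def cis_mult sum.distrib algebra_simps)

lemma cnj_torus_exp: "cnj (torus_exp m x) = torus_exp (- m) x"
  by (simp add: torus_exp_def cis_cnj sum_negf)

lemma torus_exp_reflect: "torus_exp m (- x) = torus_exp (- m) x"
  by (simp add: torus_exp_def sum_negf)

lemma continuous_on_torus_exp [continuous_intros]: "continuous_on A (torus_exp m)"
  unfolding torus_exp_def by (intro continuous_intros)

lemma torus_exp_eq_prod: "torus_exp m x = (\<Prod>i\<in>UNIV. cis (of_int (m$i) * x$i))"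
proof -
  have "cis (\<Sum>i\<in>I. g i) = (\<Prod>i\<in>I. cis (g i))" if "finite I" for I :: "'a set" and g
    using that by induction (simp_all flip: cis_mult)
  then show ?thesis
    by (simp add: torus_exp_def)
qed

lemma torus_exp_axis: "torus_exp (axis i j) x = cis (of_int j * x$i)"
proof -
  have "(\<Sum>l\<in>UNIV. of_int (axis i j $ l) * x$l) = (\<Sum>l\<in>UNIV. if l = i then of_int j * x$l else 0)"
    by (intro sum.cong) (auto simp: axis_def)
  then show ?thesis
    by (simp add: torus_exp_def)
qed

lemma torus_exp_period: "torus_exp m (x + (2 * pi) *\<^sub>R axis i 1) = torus_exp m x"
proof -
  have "(\<Sum>l\<in>UNIV. of_int (m$l) * (((2 * pi) *\<^sub>R axis i 1) :: real^'a)$l)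
      = (\<Sum>l\<in>UNIV. if l = i then 2 * pi * of_int (m$l) else 0)"
    by (intro sum.cong) (auto simp: axis_def)
  then have "torus_exp m ((2 * pi) *\<^sub>R axis i 1) = 1"
    by (simp add: torus_exp_def cis_multiple_2pi)
  then show ?thesis
    by (simp add: torus_exp_translate)
qed

text \<open>Generated from single characters, so that closure properties and integral identities are
  proved by induction from one frequency; \<open>trig_poly_expansion\<close> recovers the explicit
  finite sum.\<close>

inductive trig_poly :: "(real^'d::finite \<Rightarrow> complex) \<Rightarrow> bool" where
  monomial: "trig_poly (\<lambda>x. c * torus_exp m x)"
| add: "trig_poly p \<Longrightarrow> trig_poly q \<Longrightarrow> trig_poly (\<lambda>x. p x + q x)"

lemma trig_poly_const [intro]: "trig_poly (\<lambda>x. c)"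
  using trig_poly.monomial[of c 0] by simp

lemma trig_poly_mult: "trig_poly p \<Longrightarrow> trig_poly q \<Longrightarrow> trig_poly (\<lambda>x. p x * q x)"
proof (induction rule: trig_poly.induct)
  case (monomial c m)
  from monomial show ?case
  proof (induction rule: trig_poly.induct)
    case (monomial c' m')
    show ?case
      using trig_poly.monomial[of "c * c'" "m + m'"] by (simp add: torus_exp_add algebra_simps)
  next
    case (add p q)
    show ?case
      using trig_poly.add[OF add.IH] by (simp add: algebra_simps)
  qed
next
  case (add p p')
  show ?case
    using trig_poly.add[OF add.IH[OF add.prems]] by (simp add: algebra_simps)
qed

lemma trig_poly_sum:
  assumes "finite I" "\<And>i. i \<in> I \<Longrightarrow> trig_poly (p i)"
  shows "trig_poly (\<lambda>x. \<Sum>i\<in>I. p i x)"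
  using assms by (induction) (auto intro: trig_poly.add)

lemma trig_poly_continuous: "trig_poly p \<Longrightarrow> continuous_on A p"
  by (induction rule: trig_poly.induct) (auto intro!: continuous_intros)

lemma trig_poly_periodic: "trig_poly p \<Longrightarrow> periodic_torus p"
  by (induction rule: trig_poly.induct) (auto simp: periodic_torus_def torus_exp_period)

text \<open>Frequencies shared by two summands are merged, so each character occurs once, as
  orthogonality requires. Coefficients are extended by zero to the union of the two frequency
  sets.\<close>

lemma trig_poly_expansion:
  assumes "trig_poly p"
  obtains F c where "finite F" "p = (\<lambda>x. \<Sum>m\<in>F. c m * torus_exp m x)"
proof -
  have "\<exists>F c. finite F \<and> p = (\<lambda>x. \<Sum>m\<in>F. c m * torus_exp m x)"
    using assms
  proof (induction rule: trig_poly.induct)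
    case (monomial c m)
    have "(\<lambda>x. c * torus_exp m x) = (\<lambda>x. \<Sum>m\<in>{m}. c * torus_exp m x)"
      by simp
    then show ?case
      by (intro exI[of _ "{m}"] exI[of _ "\<lambda>_. c"]) auto
  next
    case (add p q)
    then obtain F c G d where F: "finite F" "p = (\<lambda>x. \<Sum>m\<in>F. c m * torus_exp m x)"
      and G: "finite G" "q = (\<lambda>x. \<Sum>m\<in>G. d m * torus_exp m x)"
      by blast
    have "p x + q x = (\<Sum>m\<in>F \<union> G. ((if m \<in> F then c m else 0) + (if m \<in> G then d m else 0)) * torus_exp m x)"
      for x
    proof -
      have "p x = (\<Sum>m\<in>F \<union> G. (if m \<in> F then c m else 0) * torus_exp m x)"
        unfolding F(2) by (intro sum.mono_neutral_cong_left) (use F G in auto)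
      moreover have "q x = (\<Sum>m\<in>F \<union> G. (if m \<in> G then d m else 0) * torus_exp m x)"
        unfolding G(2) by (intro sum.mono_neutral_cong_left) (use F G in auto)
      ultimately show ?thesis
        by (simp add: sum.distrib algebra_simps)
    qed
    then show ?case
      using F(1) G(1) by (intro exI[of _ "F \<union> G"] exI) auto
  qed
  then show ?thesis
    using that by blast
qed

lemma trig_poly_cis: "trig_poly (\<lambda>x. cis (x$i))" "trig_poly (\<lambda>x. cis (- x$i))"
  using trig_poly.monomial[of 1 "axis i 1"] trig_poly.monomial[of 1 "axis i (-1)"]
  by (simp_all add: torus_exp_axis)

lemma trig_poly_cos: "trig_poly (\<lambda>x. of_real (cos (x$i)))"
proof -
  have "(\<lambda>x::real^'a. complex_of_real (cos (x$i))) = (\<lambda>x. (1/2) * (cis (x$i) + cis (- x$i)))"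
    by (auto simp: complex_eq_iff)
  then show ?thesis
    by (simp only:) (intro trig_poly_mult trig_poly.add trig_poly_cis trig_poly_const)
qed

lemma trig_poly_sin: "trig_poly (\<lambda>x. of_real (sin (x$i)))"
proof -
  have "(\<lambda>x::real^'a. complex_of_real (sin (x$i))) = (\<lambda>x. (-\<i>/2) * (cis (x$i) + (-1) * cis (- x$i)))"
    by (auto simp: complex_eq_iff)
  then show ?thesis
    by (simp only:) (intro trig_poly_mult trig_poly.add trig_poly_cis trig_poly_const)
qed

text \<open>On the torus a real linear functional becomes a combination of \<open>cos (x$i)\<close>
  and \<open>sin (x$i)\<close>, which are trigonometric polynomials; sums and products follow by
  closure.\<close>

lemma trig_poly_real_polynomial:
  fixes g :: "complex^'d::finite \<Rightarrow> real"
  assumes "real_polynomial_function g"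
  shows "trig_poly (\<lambda>x. of_real (g (\<chi> i. cis (x$i))))"
  using assms
proof (induction rule: real_polynomial_function.induct)
  case (linear f)
  interpret bounded_linear f by fact
  have f_eq: "f z = (\<Sum>i\<in>UNIV. Re (z$i) * f (axis i 1) + Im (z$i) * f (axis i \<i>))" for z
  proof -
    \<comment> \<open>\<open>f\<close> is only real linear, so \<open>z\<close> is expanded in the
      real basis \<open>axis i 1\<close>, \<open>axis i \<i>\<close>.\<close>
    have "z = (\<Sum>i\<in>UNIV. Re (z$i) *\<^sub>R axis i 1 + Im (z$i) *\<^sub>R axis i \<i>)"
    proof -
      have "(\<Sum>i\<in>UNIV. Re (z$i) *\<^sub>R axis i 1 + Im (z$i) *\<^sub>R axis i \<i>) $ j
          = (\<Sum>i\<in>UNIV. if i = j then z$j else 0)" for j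
        unfolding sum_component by (intro sum.cong) (auto simp: axis_def complex_eq_iff)
      then show ?thesis
        by (simp add: vec_eq_iff)
    qed
    then have "f z = f (\<Sum>i\<in>UNIV. Re (z$i) *\<^sub>R axis i 1 + Im (z$i) *\<^sub>R axis i \<i>)"
      by (rule arg_cong)
    also have "\<dots> = (\<Sum>i\<in>UNIV. Re (z$i) * f (axis i 1) + Im (z$i) * f (axis i \<i>))"
      by (simp add: sum add scaleR)
    finally show ?thesis .
  qed
  have *: "(\<lambda>x. complex_of_real (f (\<chi> i. cis (x$i)))) =
     (\<lambda>x. \<Sum>i\<in>UNIV. of_real (cos (x$i)) * of_real (f (axis i 1)) + of_real (sin (x$i)) * of_real (f (axis i \<i>)))"
    by (rule ext, subst f_eq) simp
  show ?case
    unfolding * by (intro trig_poly_sum trig_poly.add trig_poly_mult trig_poly_cos trig_poly_sin trig_poly_const) auto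
next
  case (mult f g)
  then show ?case
    using trig_poly_mult[OF mult.IH] by simp
qed (auto intro: trig_poly.add)

section \<open>Uniform density of trigonometric polynomials\<close>

lemma cube_eq_cbox: "cube = cbox 0 (\<chi> i. 2 * pi)"
  by (auto simp: cube_def mem_box_cart)

lemma compact_cube: "compact cube"
  by (simp add: cube_eq_cbox)

theorem trig_poly_dense:
  fixes f :: "real^'d::finite \<Rightarrow> complex"
  assumes cont: "continuous_on cube f"
    and glue: "\<And>x y. x \<in> cube \<Longrightarrow> y \<in> cube \<Longrightarrow> (\<And>i. cis (x$i) = cis (y$i)) \<Longrightarrow> f x = f y"
    and "e > 0"
  obtains p where "trig_poly p" "\<And>x. x \<in> cube \<Longrightarrow> cmod (f x - p x) < e"
proof -
  define E :: "real^'d \<Rightarrow> complex^'d" where "E = (\<lambda>x. \<chi> i. cis (x$i))"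
  have contE: "continuous_on A E" for A
    unfolding E_def by (intro continuous_intros)
  have cE: "compact (E ` cube)"
    using compact_cube contE compact_continuous_image by blast
  \<comment> \<open>An arbitrary preimage is chosen; \<open>glue\<close> makes the value independent
    of the choice.\<close>
  define H where "H z = f (SOME x. x \<in> cube \<and> E x = z)" for z
  have H: "H (E x) = f x" if "x \<in> cube" for x
  proof -
    have "(SOME y. y \<in> cube \<and> E y = E x) \<in> cube \<and> E (SOME y. y \<in> cube \<and> E y = E x) = E x"
      by (rule someI[of _ x]) (use that in auto)
    then show ?thesis
      unfolding H_def using that by (intro glue) (auto simp: E_def vec_eq_iff)
  qed
  \<comment> \<open>\<open>E\<close> maps compact sets to compact sets, so the preimage under
    \<open>H\<close> of a closed set, being the image of a compact one, is closed.\<close>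
  have "continuous_on (E ` cube) H"
    unfolding continuous_on_closed_vimage[OF compact_imp_closed[OF cE]]
  proof (intro allI impI)
    fix B :: "complex set" assume B: "closed B"
    have "H -` B \<inter> E ` cube = E ` (cube \<inter> f -` B)"
      using H by force
    moreover have "compact (cube \<inter> f -` B)"
      using B cont compact_cube by (metis closedin_compact continuous_closedin_preimage)
    ultimately show "closed (H -` B \<inter> E ` cube)"
      using contE compact_continuous_image compact_imp_closed by metis
  qed
  from Stone_Weierstrass_polynomial_function[OF cE this \<open>e > 0\<close>]
  obtain g where g: "polynomial_function g" "\<forall>z\<in>E ` cube. cmod (H z - g z) < e"
    by blast
  have "real_polynomial_function (Re \<circ> g)" "real_polynomial_function (Im \<circ> g)"
    using g(1) bounded_linear_Re bounded_linear_Im unfolding polynomial_function_def by blast+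
  then have "trig_poly (\<lambda>x. of_real ((Re \<circ> g) (E x)))" "trig_poly (\<lambda>x. of_real ((Im \<circ> g) (E x)))"
    unfolding E_def by (auto dest: trig_poly_real_polynomial simp del: o_apply)
  then have "trig_poly (\<lambda>x. of_real ((Re \<circ> g) (E x)) + \<i> * of_real ((Im \<circ> g) (E x)))"
    by (intro trig_poly.add trig_poly_mult trig_poly_const)
  then have "trig_poly (\<lambda>x. g (E x))"
    by (simp flip: complex_eq)
  moreover have "cmod (f x - g (E x)) < e" if "x \<in> cube" for x
    using g(2) that H by force
  ultimately show ?thesis
    using that by blast
qed

section \<open>Periodic functions and their representatives in the cube\<close>

lemma periodic_torus_multiple:
  assumes "periodic_torus f"
  shows "f (x + (2 * pi * of_int n) *\<^sub>R axis i 1) = f x"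
proof -
  have nat: "f (x + (2 * pi * real n) *\<^sub>R axis i 1) = f x" for x n
  proof (induction n)
    case (Suc n)
    have "x + (2 * pi * real (Suc n)) *\<^sub>R axis i 1 = (x + (2 * pi * real n) *\<^sub>R axis i 1) + (2 * pi) *\<^sub>R axis i 1"
      by (simp add: algebra_simps)
    then show ?case
      using assms Suc by (simp only: periodic_torus_def)
  qed simp
  show ?thesis
  proof (cases "n \<ge> 0")
    case True
    then show ?thesis using nat[of x "nat n"] by simp
  next
    case False
    have "f (x + (2 * pi * of_int n) *\<^sub>R axis i 1) =
        f (x + (2 * pi * of_int n) *\<^sub>R axis i 1 + (2 * pi * real (nat (- n))) *\<^sub>R axis i 1)"
      by (rule nat[symmetric])
    also have "\<dots> = f x"
      using False by (simp add: add.assoc flip: scaleR_left.add distrib_left)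
    finally show ?thesis .
  qed
qed

lemma periodic_torus_lattice:
  assumes "periodic_torus f"
  shows "f (x + (\<chi> i. 2 * pi * of_int (n$i))) = f x"
proof -
  have "f (x + (\<Sum>i\<in>I. (2 * pi * of_int (n$i)) *\<^sub>R axis i 1)) = f x" if "finite I" for I
    using that
  proof (induction I)
    case (insert i I)
    then show ?case
      using periodic_torus_multiple[OF assms,
          of "x + (\<Sum>i\<in>I. (2 * pi * of_int (n$i)) *\<^sub>R axis i 1)" "n$i" i]
      by (simp add: algebra_simps)
  qed simp
  moreover have "(\<Sum>i\<in>UNIV. (2 * pi * of_int (n$i)) *\<^sub>R axis i 1) = (\<chi> i. 2 * pi * of_int (n$i))"
    by (auto simp: vec_eq_iff axis_def if_distrib sum.If_cases cong: if_cong)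
  ultimately show ?thesis
    by (metis finite)
qed

text \<open>Taking fractional parts of \<open>x$i / (2 * pi)\<close> moves \<open>x\<close> into the
  cube. One \<open>y\<close> serves all periodic functions at once, so it can be used for
  \<open>f - p\<close> with \<open>p\<close> chosen later.\<close>

lemma periodic_torus_representative:
  fixes x :: "real^'d::finite"
  obtains y where "y \<in> cube" "\<And>f :: real^'d \<Rightarrow> 'b. periodic_torus f \<Longrightarrow> f x = f y"
proof
  define n :: "int^'d" where "n = (\<chi> i. - \<lfloor>x$i / (2 * pi)\<rfloor>)"
  define y where "y = x + (\<chi> i. 2 * pi * of_int (n$i))"
  show "y \<in> cube"
    unfolding cube_def
  proof (intro CollectI allI)
    fix i
    define k where "k = real_of_int \<lfloor>x$i / (2 * pi)\<rfloor>"
    have "k \<le> x$i / (2 * pi)" "x$i / (2 * pi) \<le> k + 1"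
      unfolding k_def by linarith+
    then have "k * (2 * pi) \<le> x$i" "x$i \<le> (k + 1) * (2 * pi)"
      by (simp_all add: pos_le_divide_eq pos_divide_le_eq)
    then show "0 \<le> y$i \<and> y$i \<le> 2 * pi"
      by (simp add: y_def n_def k_def algebra_simps)
  qed
  show "f x = f y" if "periodic_torus f" for f :: "real^'d \<Rightarrow> 'b"
    unfolding y_def using periodic_torus_lattice[OF that] by metis
qed

text \<open>The error is controlled on the whole space because arguments such as
  \<open>t + x\<close> leave the cube; \<open>f - p\<close> is periodic, so its size is decided on
  the cube.\<close>

corollary trig_poly_dense_periodic:
  fixes f :: "real^'d::finite \<Rightarrow> complex"
  assumes cont: "continuous_on UNIV f" and per: "periodic_torus f" and "e > 0"
  obtains p where "trig_poly p" "\<And>x. cmod (f x - p x) < e"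
proof -
  have glue: "f x = f y" if "\<And>i. cis (x$i) = cis (y$i)" for x y
  proof -
    have "\<exists>n::int. y$i = x$i + 2 * pi * of_int n" for i
    proof -
      have "cos (y$i) = cos (x$i)" "sin (y$i) = sin (x$i)"
        using that[of i] by (auto simp: complex_eq_iff)
      then show ?thesis
        using sin_cos_eq_iff by (auto simp: mult.commute)
    qed
    then obtain n where "\<And>i. y$i = x$i + 2 * pi * of_int (n i :: int)"
      by metis
    then have "y = x + (\<chi> i. 2 * pi * of_int ((\<chi> i. n i)$i))"
      by (simp add: vec_eq_iff)
    then show ?thesis
      using periodic_torus_lattice[OF per] by metis
  qed
  obtain p where p: "trig_poly p" "\<And>x. x \<in> cube \<Longrightarrow> cmod (f x - p x) < e"
    using trig_poly_dense[OF continuous_on_subset[OF cont] glue \<open>e > 0\<close>] by auto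
  have "cmod (f x - p x) < e" for x
  proof -
    have "periodic_torus (\<lambda>x. f x - p x)"
      using per trig_poly_periodic[OF p(1)] by (simp add: periodic_torus_def)
    moreover obtain y where "y \<in> cube" "\<And>f :: real^'d \<Rightarrow> complex. periodic_torus f \<Longrightarrow> f x = f y"
      using periodic_torus_representative[of x, where 'b = complex] by blast
    ultimately show ?thesis
      using p(2) by metis
  qed
  with p(1) show ?thesis
    using that by blast
qed

section \<open>Orthogonality of the characters\<close>

abbreviation torus :: "(real^'d::finite) measure" where
  "torus \<equiv> lebesgue_on cube"

lemma cube_lmeasurable: "cube \<in> lmeasurable"
  by (simp add: cube_eq_cbox)

lemma finite_measure_torus: "finite_measure torus"
  by (rule finite_measure_lebesgue_on[OF cube_lmeasurable])

lemma torus_measurable_continuous: "continuous_on cube f \<Longrightarrow> f \<in> borel_measurable torus"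
  by (rule continuous_imp_measurable_on_sets_lebesgue) (auto simp: cube_lmeasurable fmeasurableD)

lemma torus_integrable_bounded:
  fixes f :: "real^'d::finite \<Rightarrow> 'b::{banach,second_countable_topology}"
  assumes "f \<in> borel_measurable torus" "\<And>x. x \<in> cube \<Longrightarrow> norm (f x) \<le> B"
  shows "integrable torus f"
proof -
  interpret finite_measure "torus :: (real^'d) measure"
    by (rule finite_measure_torus)
  show ?thesis
    using assms by (intro integrable_const_bound[of _ B]) (auto intro!: AE_I2)
qed

lemma torus_integrable_continuous:
  fixes f :: "real^'d::finite \<Rightarrow> 'b::{banach,second_countable_topology}"
  assumes "continuous_on cube f"
  shows "integrable torus f"
proof -
  have "bounded (f ` cube)"
    by (rule compact_imp_bounded[OF compact_continuous_image[OF assms compact_cube]])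
  then obtain B where "\<forall>y\<in>f ` cube. norm y \<le> B"
    unfolding bounded_iff by (elim exE)
  then show ?thesis
    by (intro torus_integrable_bounded[of f B] torus_measurable_continuous assms) simp
qed

lemma integral_cis_int:
  fixes n :: int
  shows "(LINT t|lborel. indicator {0..2*pi} t *\<^sub>R cis (of_int n * t)) = (if n = 0 then 2 * pi else 0)"
proof (cases "n = 0")
  case True
  have "(complex_of_real has_vector_derivative 1) (at t within {0..2*pi})" for t
    using has_vector_derivative_of_real[OF DERIV_ident[of "at t within {0..2*pi}"]]
    by simp
  from integral_FTC_Icc[of 0 "2 * pi", OF _ this] show ?thesis
    using True by simp
next
  case False
  define F where "F t = - (\<i> / of_int n) * cis (of_int n * t)" for t
  have "(F has_vector_derivative cis (of_int n * t)) (at t within {0..2*pi})" for t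
  proof -
    have "((\<lambda>z. - (\<i> / of_int n) * exp (\<i> * of_int n * z)) has_field_derivative exp (\<i> * of_int n * of_real t))
        (at (of_real t))"
      using False by (auto intro!: derivative_eq_intros)
    from has_vector_derivative_real_field[OF this] show ?thesis
      by (simp add: F_def[abs_def] cis_conv_exp mult.assoc)
  qed
  then have "(LINT t|lborel. indicator {0..2*pi} t *\<^sub>R cis (of_int n * t)) = F (2 * pi) - F 0"
    by (intro integral_FTC_Icc continuous_intros) auto
  also have "F (2 * pi) = F 0"
    using cis_multiple_2pi[of "of_int n"] by (simp add: F_def mult_ac)
  finally show ?thesis
    using False by simp
qed

text \<open>A character is a product of functions of one coordinate each, so the integral factors
  into one-dimensional integrals, one of which vanishes unless \<open>m = 0\<close>.\<close>

lemma torus_int_torus_exp: "torus_int (torus_exp m :: real^'d::finite \<Rightarrow> complex) = (if m = 0 then (2 * pi) ^ CARD('d) else 0)"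
proof -
  interpret product_sigma_finite "\<lambda>_. lborel :: real measure" ..
  \<comment> \<open>The factors are indexed by basis vectors, as in the product description of
    \<open>lborel\<close>, and each carries its own indicator, so that their product already
    restricts to the cube.\<close>
  define g where "g b t = indicator {0..2*pi} t *\<^sub>R cis (of_int (m $ axis_index b) * t)" for b :: "real^'d" and t
  have [measurable]: "cube \<in> sets borel" "torus_exp m \<in> borel_measurable borel"
    by (auto simp: cube_eq_cbox intro!: borel_measurable_continuous_onI continuous_intros)
  have int: "integrable lborel (g b)" for b
    unfolding g_def by (rule borel_integrable_compact) (auto intro!: continuous_intros)
  have [measurable]: "g b \<in> borel_measurable borel" for b
    using int by (simp add: borel_measurable_integrable)
  have Basis: "(Basis :: (real^'d) set) = range (\<lambda>i. axis i 1)"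
    by (auto simp: Basis_vec_def)
  have reindex: "(\<Prod>b\<in>Basis. h b) = (\<Prod>i\<in>UNIV. h (axis i 1))" for h :: "real^'d \<Rightarrow> complex"
    unfolding Basis by (subst prod.reindex) (auto simp: inj_on_def axis_eq_axis)
  have g: "indicator cube x *\<^sub>R torus_exp m x = (\<Prod>b\<in>Basis. g b (x \<bullet> b))" for x
  proof -
    have "(\<Prod>b\<in>Basis. g b (x \<bullet> b)) = (\<Prod>i\<in>UNIV. indicator {0..2*pi} (x$i) *\<^sub>R cis (of_int (m$i) * x$i))"
      by (simp add: reindex g_def inner_axis)
    also have "\<dots> = (\<Prod>i\<in>UNIV. of_real (indicator {0..2*pi} (x$i))) * torus_exp m x"
      by (simp add: scaleR_conv_of_real prod.distrib torus_exp_eq_prod)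
    also have "(\<Prod>i\<in>UNIV. of_real (indicator {0..2*pi} (x$i))) = (of_real (indicator cube x) :: complex)"
    proof (cases "x \<in> cube")
      case True
      then show ?thesis
        by (simp add: cube_def)
    next
      case False
      then obtain i where "x$i \<notin> {0..2*pi}"
        by (auto simp: cube_def)
      then have "\<exists>i\<in>UNIV. complex_of_real (indicator {0..2*pi} (x$i)) = 0"
        by (intro bexI[of _ i]) auto
      with False show ?thesis
        by (subst prod_zero) auto
    qed
    finally show ?thesis
      by (simp add: scaleR_conv_of_real)
  qed
  \<comment> \<open>The measure is changed in three stages: restricted Lebesgue measure, Borel
    measure, finite product of one-dimensional measures.\<close>
  have "torus_int (torus_exp m) = (LINT x|lebesgue. indicator cube x *\<^sub>R torus_exp m x)"
    unfolding torus_int_def by (rule integral_restrict_space) (simp add: cube_lmeasurable fmeasurableD)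
  also have "\<dots> = (LINT x|lborel. indicator cube x *\<^sub>R torus_exp m x)"
    by (rule integral_completion) measurable
  also have "\<dots> = (LINT x|lborel. (\<Prod>b\<in>Basis. g b (x \<bullet> b)))"
    by (simp add: g)
  also have "\<dots> = integral\<^sup>L (Pi\<^sub>M Basis (\<lambda>_. lborel)) (\<lambda>f. \<Prod>b\<in>Basis. g b ((\<Sum>b\<in>Basis. f b *\<^sub>R b) \<bullet> b))"
    by (subst lborel_eq, rule integral_distr) measurable
  also have "\<dots> = integral\<^sup>L (Pi\<^sub>M Basis (\<lambda>_. lborel)) (\<lambda>f. \<Prod>b\<in>Basis. g b (f b))"
    by (intro Bochner_Integration.integral_cong prod.cong) (auto simp: inner_sum_left inner_Basis if_distrib cong: if_cong)
  also have "\<dots> = (\<Prod>b\<in>Basis. integral\<^sup>L lborel (g b))"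
    by (rule product_integral_prod) (auto intro: int)
  also have "\<dots> = (\<Prod>i\<in>UNIV. if m$i = 0 then 2 * pi else 0)"
    unfolding reindex g_def axis_index_axis integral_cis_int by simp
  also have "\<dots> = (if m = 0 then (2 * pi) ^ CARD('d) else 0)"
    by (auto simp: vec_eq_iff)
  finally show ?thesis .
qed

lemma torus_int_1:
  fixes c :: complex
  shows "torus_int (\<lambda>x::real^'d::finite. c) = (2 * pi) ^ CARD('d) * c"
proof -
  have "torus_int (\<lambda>x::real^'d. c * torus_exp 0 x) = c * torus_int (torus_exp 0 :: real^'d \<Rightarrow> complex)"
    unfolding torus_int_def by (rule integral_mult_right_zero)
  then show ?thesis
    unfolding torus_int_torus_exp by simp
qed

lemma measure_torus: "measure torus (space (torus :: (real^'d::finite) measure)) = (2 * pi) ^ CARD('d)"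
proof -
  have "of_real (measure torus (space (torus :: (real^'d) measure))) = torus_int (\<lambda>x::real^'d. 1 :: complex)"
    by (simp add: torus_int_def scaleR_conv_of_real)
  also have "\<dots> = of_real ((2 * pi) ^ CARD('d))"
    using torus_int_1[where c = 1 and 'd = 'd] by simp
  finally show ?thesis
    using of_real_eq_iff by blast
qed

section \<open>Square-integrable functions and finite Fourier sums\<close>

definition square_integrable :: "(real^'d::finite \<Rightarrow> complex) \<Rightarrow> bool" where
  "square_integrable f \<longleftrightarrow> f \<in> borel_measurable torus \<and> integrable torus (\<lambda>x. (cmod (f x))^2)"

lemma square_integrable_measurable: "square_integrable f \<Longrightarrow> f \<in> borel_measurable torus"
  by (simp add: square_integrable_def)

lemma square_integrable_norm: "square_integrable f \<Longrightarrow> integrable torus (\<lambda>x. (cmod (f x))^2)"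
  by (simp add: square_integrable_def)

lemma square_integrable_continuous: "continuous_on cube f \<Longrightarrow> square_integrable f"
  unfolding square_integrable_def
  by (intro conjI torus_measurable_continuous torus_integrable_continuous continuous_intros)

lemma square_integrable_bounded:
  assumes "f \<in> borel_measurable torus" "\<And>x. x \<in> cube \<Longrightarrow> cmod (f x) \<le> B"
  shows "square_integrable f"
  unfolding square_integrable_def
  using assms by (intro conjI torus_integrable_bounded[of _ "B^2"]) (auto intro: power_mono)

lemma square_integrable_diff:
  assumes "square_integrable f" "square_integrable g"
  shows "square_integrable (\<lambda>x. f x - g x)"
proof -
  have [measurable]: "f \<in> borel_measurable torus" "g \<in> borel_measurable torus"
    using assms by (simp_all add: square_integrable_def)
  have bound: "(cmod (f x - g x))^2 \<le> 2 * (cmod (f x))^2 + 2 * (cmod (g x))^2" for x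
  proof -
    have "(cmod (f x - g x))^2 \<le> (cmod (f x) + cmod (g x))^2"
      by (intro power_mono norm_triangle_ineq4) auto
    also have "\<dots> \<le> 2 * (cmod (f x))^2 + 2 * (cmod (g x))^2"
      using sum_squares_bound[of "cmod (f x)" "cmod (g x)"] by (simp add: power2_sum)
    finally show ?thesis .
  qed
  have "integrable torus (\<lambda>x. (cmod (f x - g x))^2)"
  proof (rule Bochner_Integration.integrable_bound)
    show "integrable torus (\<lambda>x. 2 * (cmod (f x))^2 + 2 * (cmod (g x))^2)"
      by (intro Bochner_Integration.integrable_add integrable_mult_right square_integrable_norm assms)
    show "AE x in torus. norm ((cmod (f x - g x))^2) \<le> norm (2 * (cmod (f x))^2 + 2 * (cmod (g x))^2)"
      using bound by (intro AE_I2) (simp only: real_norm_def, metis abs_ge_self abs_of_nonneg order_trans zero_le_power2)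
  qed measurable
  then show ?thesis
    by (simp add: square_integrable_def)
qed

lemma square_integrable_mult:
  assumes "square_integrable f" "square_integrable g"
  shows "integrable torus (\<lambda>x. f x * g x)"
proof -
  have [measurable]: "f \<in> borel_measurable torus" "g \<in> borel_measurable torus"
    using assms by (simp_all add: square_integrable_def)
  have bound: "cmod (f x) * cmod (g x) \<le> (cmod (f x))^2 + (cmod (g x))^2" for x
    using sum_squares_bound[of "cmod (f x)" "cmod (g x)"] mult_nonneg_nonneg[of "cmod (f x)" "cmod (g x)"]
    by (simp add: mult.assoc del: mult_nonneg_nonneg)
  show ?thesis
  proof (rule Bochner_Integration.integrable_bound)
    show "integrable torus (\<lambda>x. (cmod (f x))^2 + (cmod (g x))^2)"
      by (intro Bochner_Integration.integrable_add square_integrable_norm assms)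
    show "AE x in torus. norm (f x * g x) \<le> norm ((cmod (f x))^2 + (cmod (g x))^2)"
      using bound by (intro AE_I2) (simp only: real_norm_def norm_mult, metis abs_ge_self order_trans)
  qed measurable
qed

lemma square_integrable_const: "square_integrable (\<lambda>x. c)"
  by (intro square_integrable_continuous continuous_intros)

lemma square_integrable_integrable: "square_integrable f \<Longrightarrow> integrable torus f"
  using square_integrable_mult[OF _ square_integrable_const[of 1]] by simp

lemma square_integrable_cnj: "square_integrable f \<Longrightarrow> square_integrable (\<lambda>x. cnj (f x))"
  using measurable_compose[of f torus borel cnj borel] borel_measurable_continuous_onI[of cnj]
  by (simp add: square_integrable_def continuous_on_cnj)

lemma square_integrable_torus_exp: "square_integrable (torus_exp m)"
  by (intro square_integrable_continuous continuous_intros)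

lemma fcoeff_eq: "fcoeff f m = torus_int (\<lambda>x. f x * cnj (torus_exp m x))"
  by (simp add: fcoeff_def torus_exp_def cis_cnj)

lemma mass_diff:
  assumes "square_integrable f" "square_integrable g"
  shows "mass (\<lambda>x. f x - g x) = mass f - 2 * Re (torus_int (\<lambda>x. f x * cnj (g x))) + mass g"
proof -
  have "(cmod (f x - g x))^2 = (cmod (f x))^2 - 2 * Re (f x * cnj (g x)) + (cmod (g x))^2" for x
    unfolding cmod_power2 by (simp add: power2_eq_square algebra_simps)
  moreover have "integrable torus (\<lambda>x. f x * cnj (g x))"
    by (rule square_integrable_mult[OF assms(1) square_integrable_cnj[OF assms(2)]])
  ultimately show ?thesis
    unfolding mass_def torus_int_def using assms[THEN square_integrable_norm]
    by (simp del: times_complex.sel)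
qed

text \<open>Parseval for finite sums: expanding the square gives characters
  \<open>torus_exp (m - n)\<close>, and orthogonality leaves the diagonal.\<close>

lemma mass_trig_sum:
  fixes c :: "int^'d::finite \<Rightarrow> complex"
  assumes "finite F"
  shows "mass (\<lambda>x. \<Sum>m\<in>F. c m * torus_exp m x) = (2 * pi) ^ CARD('d) * (\<Sum>m\<in>F. (cmod (c m))^2)"
proof -
  have "complex_of_real (mass (\<lambda>x. \<Sum>m\<in>F. c m * torus_exp m x)) = torus_int (\<lambda>x. complex_of_real ((cmod (\<Sum>m\<in>F. c m * torus_exp m x))^2))"
    by (simp add: mass_def torus_int_def del: of_real_power)
  also have "\<dots> = torus_int (\<lambda>x. \<Sum>m\<in>F. \<Sum>n\<in>F. c m * cnj (c n) * torus_exp (m - n) x)"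
  proof -
    have "of_real ((cmod (\<Sum>m\<in>F. c m * torus_exp m x))^2) = (\<Sum>m\<in>F. \<Sum>n\<in>F. c m * cnj (c n) * torus_exp (m - n) x)" for x
    proof -
      have "torus_exp (m - n) x = torus_exp m x * cnj (torus_exp n x)" for m n
        using torus_exp_add[of m "- n" x] by (simp add: cnj_torus_exp)
      then show ?thesis
        unfolding complex_norm_square cnj_sum sum_product by (intro sum.cong refl) simp
    qed
    then show ?thesis
      by simp
  qed
  also have "\<dots> = (\<Sum>m\<in>F. \<Sum>n\<in>F. c m * cnj (c n) * torus_int (torus_exp (m - n)))"
  proof -
    have int: "integrable torus (\<lambda>x. k * torus_exp n x)" for k and n :: "int^'d"
      by (intro integrable_mult_right square_integrable_integrable square_integrable_torus_exp)
    show ?thesis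
      unfolding torus_int_def
      by (simp add: Bochner_Integration.integral_sum Bochner_Integration.integrable_sum int)
  qed
  also have "\<dots> = (\<Sum>m\<in>F. \<Sum>n\<in>F. if n = m then c m * cnj (c m) * (2 * pi) ^ CARD('d) else 0)"
    by (intro sum.cong) (auto simp: torus_int_torus_exp)
  also have "\<dots> = of_real ((2 * pi) ^ CARD('d) * (\<Sum>m\<in>F. (cmod (c m))^2))"
    using assms
    by (simp add: sum_distrib_left sum_distrib_right complex_norm_square[symmetric] mult.commute flip: of_real_power)
  finally show ?thesis
    using of_real_eq_iff by blast
qed

text \<open>The left side is the squared distance from \<open>f\<close> to the span of the
  characters in \<open>F\<close>. Completing the square in each \<open>c m\<close> gives the bound,
  with equality at \<open>c m = fcoeff f m / L\<close>.\<close>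

lemma best_approximation:
  fixes f :: "real^'d::finite \<Rightarrow> complex"
  assumes f: "square_integrable f" and "finite F"
  shows "mass f - (\<Sum>m\<in>F. (cmod (fcoeff f m))^2) / (2 * pi) ^ CARD('d)
      \<le> mass (\<lambda>x. f x - (\<Sum>m\<in>F. c m * torus_exp m x))"
proof -
  define L :: real where "L = (2 * pi) ^ CARD('d)"
  have L: "L > 0"
    by (simp add: L_def)
  have "torus_int (\<lambda>x. f x * cnj (\<Sum>m\<in>F. c m * torus_exp m x))
      = torus_int (\<lambda>x. \<Sum>m\<in>F. cnj (c m) * (f x * cnj (torus_exp m x)))"
    by (simp add: sum_distrib_left algebra_simps)
  also have "\<dots> = (\<Sum>m\<in>F. cnj (c m) * fcoeff f m)"
    unfolding torus_int_def fcoeff_eq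
    by (subst Bochner_Integration.integral_sum)
       (auto intro!: integrable_mult_right square_integrable_mult f square_integrable_torus_exp square_integrable_cnj
          simp del: complex_cnj_mult integrable_mult_left_iff integrable_mult_right_iff)
  finally have *: "mass (\<lambda>x. f x - (\<Sum>m\<in>F. c m * torus_exp m x))
      = mass f - 2 * (\<Sum>m\<in>F. Re (cnj (c m) * fcoeff f m)) + L * (\<Sum>m\<in>F. (cmod (c m))^2)"
    using assms
    by (subst mass_diff) (auto simp: mass_trig_sum L_def intro!: square_integrable_continuous continuous_intros)
  have "2 * Re (cnj (c m) * fcoeff f m) - L * (cmod (c m))^2 \<le> (cmod (fcoeff f m))^2 / L" for m
  proof -
    have "0 \<le> (cmod (fcoeff f m - L * c m))^2 / L"
      using L by simp
    also have "(cmod (fcoeff f m - L * c m))^2 =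
        (cmod (fcoeff f m))^2 - 2 * L * Re (cnj (c m) * fcoeff f m) + L^2 * (cmod (c m))^2"
      unfolding cmod_power2 by (simp add: power2_eq_square algebra_simps)
    also have "\<dots> / L = (cmod (fcoeff f m))^2 / L - 2 * Re (cnj (c m) * fcoeff f m) + L * (cmod (c m))^2"
      using L by (simp add: field_simps power2_eq_square)
    finally show ?thesis
      by simp
  qed
  then have "(\<Sum>m\<in>F. 2 * Re (cnj (c m) * fcoeff f m) - L * (cmod (c m))^2) \<le> (\<Sum>m\<in>F. (cmod (fcoeff f m))^2 / L)"
    by (rule sum_mono)
  then show ?thesis
    unfolding * L_def[symmetric] by (simp add: sum_subtractf sum_distrib_left sum_divide_distrib)
qed

section \<open>Completeness in the space of square-integrable functions\<close>

lemma torus_integral_mono: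
  fixes f g :: "real^'d::finite \<Rightarrow> real"
  assumes "integrable torus f" "integrable torus g" "\<And>x. x \<in> cube \<Longrightarrow> f x \<le> g x"
  shows "torus_int f \<le> torus_int g"
  unfolding torus_int_def using assms by (intro integral_mono) auto

lemma mass_nonneg: "mass f \<ge> 0"
  by (simp add: mass_def torus_int_def)

text \<open>\<open>mass\<close> is a squared norm, so the triangle inequality costs a factor
  2.\<close>

lemma mass_triangle:
  assumes "square_integrable f" "square_integrable g" "square_integrable h"
  shows "mass (\<lambda>x. f x - h x) \<le> 2 * mass (\<lambda>x. f x - g x) + 2 * mass (\<lambda>x. g x - h x)"
proof -
  have *: "(cmod (f x - h x))^2 \<le> 2 * (cmod (f x - g x))^2 + 2 * (cmod (g x - h x))^2" for x
  proof -
    have "(cmod (f x - h x))^2 \<le> (cmod (f x - g x) + cmod (g x - h x))^2"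
      using norm_triangle_ineq[of "f x - g x" "g x - h x"] by (intro power_mono) auto
    also have "\<dots> \<le> 2 * (cmod (f x - g x))^2 + 2 * (cmod (g x - h x))^2"
      using sum_squares_bound[of "cmod (f x - g x)" "cmod (g x - h x)"] by (simp add: power2_sum)
    finally show ?thesis .
  qed
  have int: "integrable torus (\<lambda>x. (cmod (f x - h x))^2)" "integrable torus (\<lambda>x. (cmod (f x - g x))^2)"
    "integrable torus (\<lambda>x. (cmod (g x - h x))^2)"
    using assms by (auto intro!: square_integrable_norm square_integrable_diff)
  have "mass (\<lambda>x. f x - h x) \<le> torus_int (\<lambda>x. 2 * (cmod (f x - g x))^2 + 2 * (cmod (g x - h x))^2)"
    unfolding mass_def
    by (intro torus_integral_mono Bochner_Integration.integrable_add integrable_mult_right int *)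
  also have "\<dots> = 2 * mass (\<lambda>x. f x - g x) + 2 * mass (\<lambda>x. g x - h x)"
    using int by (simp add: mass_def torus_int_def)
  finally show ?thesis .
qed

lemma mass_uniform_bound:
  assumes "square_integrable (f :: real^'d::finite \<Rightarrow> complex)" "\<And>x. x \<in> cube \<Longrightarrow> cmod (f x) \<le> B"
  shows "mass f \<le> (2 * pi) ^ CARD('d) * B^2"
proof -
  have "mass f \<le> torus_int (\<lambda>x::real^'d. B^2)"
    unfolding mass_def using assms
    by (intro torus_integral_mono square_integrable_norm torus_integrable_continuous continuous_intros power_mono) auto
  also have "\<dots> = (2 * pi) ^ CARD('d) * B^2"
    using measure_torus[where 'd = 'd] by (simp add: torus_int_def)
  finally show ?thesis .
qed

section \<open>Density of trigonometric polynomials in the square-integrable functions\<close>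

lemma mass_dominated_convergence:
  fixes f :: "real^'d::finite \<Rightarrow> complex"
  assumes [measurable]: "f \<in> borel_measurable torus" "\<And>n. g n \<in> borel_measurable torus"
    and w: "integrable torus w"
    and bound: "\<And>n x. x \<in> cube \<Longrightarrow> (cmod (f x - g n x))^2 \<le> w x"
    and lim: "AE x in torus. (\<lambda>n. g n x) \<longlonglongrightarrow> f x"
  shows "(\<lambda>n. mass (\<lambda>x. f x - g n x)) \<longlonglongrightarrow> 0"
proof -
  have "(\<lambda>n. LINT x|torus. (cmod (f x - g n x))^2) \<longlonglongrightarrow> (LINT x|(torus :: (real^'d) measure). 0)"
  proof (rule integral_dominated_convergence)
    show "AE x in torus. (\<lambda>n. (cmod (f x - g n x))^2) \<longlonglongrightarrow> 0"
      using lim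
    proof eventually_elim
      case (elim x)
      then have "(\<lambda>n. (cmod (f x - g n x))^2) \<longlonglongrightarrow> (cmod (f x - f x))^2"
        by (intro tendsto_intros)
      then show ?case
        by simp
    qed
    show "AE x in torus. norm ((cmod (f x - g n x))^2) \<le> w x" for n
      using bound by (intro AE_I2) simp
  qed (use w in \<open>measurable\<close>)
  then show ?thesis
    by (simp add: mass_def torus_int_def)
qed

text \<open>Cutting \<open>f\<close> to zero where it exceeds \<open>n\<close> converges pointwise,
  with squared error dominated by the square of \<open>cmod (f x)\<close>.\<close>

lemma bounded_dense:
  assumes f: "square_integrable f" and "e > 0"
  obtains B g where "g \<in> borel_measurable torus" "\<And>x. cmod (g x) \<le> B" "mass (\<lambda>x. f x - g x) < e"
proof -
  have [measurable]: "f \<in> borel_measurable torus"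
    using f by (rule square_integrable_measurable)
  define g where "g n x = (if cmod (f x) \<le> real n then f x else 0)" for n x
  have meas: "g n \<in> borel_measurable torus" for n
    unfolding g_def by measurable
  have "(\<lambda>n. mass (\<lambda>x. f x - g n x)) \<longlonglongrightarrow> 0"
  proof (rule mass_dominated_convergence)
    show "integrable torus (\<lambda>x. (cmod (f x))^2)"
      by (rule square_integrable_norm[OF f])
    have "(\<lambda>n. g n x) \<longlonglongrightarrow> f x" for x
    proof (rule tendsto_eventually)
      obtain N where "cmod (f x) \<le> real N"
        using real_arch_simple by blast
      then show "\<forall>\<^sub>F n in sequentially. g n x = f x"
        unfolding eventually_sequentially g_def by (intro exI[of _ N]) auto
    qed
    then show "AE x in torus. (\<lambda>n. g n x) \<longlonglongrightarrow> f x"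
      by simp
  qed (auto simp: meas g_def)
  then have "\<forall>\<^sub>F n in sequentially. mass (\<lambda>x. f x - g n x) < e"
    using \<open>e > 0\<close> by (rule order_tendstoD)
  then obtain n where "mass (\<lambda>x. f x - g n x) < e"
    by (auto simp: eventually_sequentially)
  moreover have "cmod (g n x) \<le> real n" for x
    by (simp add: g_def)
  ultimately show ?thesis
    using that meas by blast
qed

text \<open>Measurability supplies continuous functions converging almost everywhere. Projecting
  their values to the ball of radius \<open>B\<close> provides a dominating constant, and a cutoff
  makes them vanish on the faces, so that the result is compatible with gluing opposite
  faces.\<close>

lemma continuous_dense:
  fixes f :: "real^'d::finite \<Rightarrow> complex"
  assumes f: "f \<in> borel_measurable torus" and B: "\<And>x. cmod (f x) \<le> B" and "e > 0"
  obtains h where "continuous_on UNIV h" "\<And>x i. x$i = 0 \<or> x$i = 2 * pi \<Longrightarrow> h x = 0"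
    "mass (\<lambda>x. f x - h x) < e"
proof -
  have "B \<ge> 0"
    using B[of undefined] norm_ge_zero order_trans by blast
  have "f measurable_on cube"
    using f by (simp add: measurable_on_iff_borel_measurable cube_lmeasurable fmeasurableD)
  then obtain N G where N: "negligible N" and contG: "\<And>n. continuous_on UNIV (G n)"
    and lim: "\<And>x. x \<notin> N \<Longrightarrow> (\<lambda>n. G n x) \<longlonglongrightarrow> (if x \<in> cube then f x else 0)"
    unfolding measurable_on_def by blast
  \<comment> \<open>Each factor vanishes outside the open interval from 0 to \<open>2 * pi\<close>
    and is eventually 1 at every point inside it.\<close>
  define cutoff where "cutoff n x = (\<Prod>i\<in>UNIV. min 1 (real n * max 0 (x$i * (2 * pi - x$i))))" for n and x :: "real^'d"
  define clamp where "clamp = closest_point (cball (0::complex) B)"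
  define h where "h n x = of_real (cutoff n x) * clamp (G n x)" for n x
  have ball: "convex (cball (0::complex) B)" "closed (cball (0::complex) B)" "cball (0::complex) B \<noteq> {}"
    using \<open>B \<ge> 0\<close> by auto
  have clamp_le: "cmod (clamp z) \<le> B" for z
    using closest_point_in_set[OF ball(2,3)] by (simp add: clamp_def)
  have clamp_eq: "clamp z = z" if "cmod z \<le> B" for z
    using that by (simp add: clamp_def closest_point_self)
  have cont_clamp: "continuous_on A clamp" for A
    unfolding clamp_def by (rule continuous_on_closest_point[OF ball])
  have cutoff: "0 \<le> cutoff n x" "cutoff n x \<le> 1" for n x
    unfolding cutoff_def by (auto intro!: prod_nonneg prod_le_1)
  have cont: "continuous_on UNIV (h n)" for n
    unfolding h_def cutoff_def
    by (intro continuous_intros continuous_on_compose2[OF cont_clamp[of UNIV] contG] subset_UNIV)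
  have zero: "h n x = 0" if "x$i = 0 \<or> x$i = 2 * pi" for n x i
  proof -
    have "cutoff n x = 0"
      unfolding cutoff_def by (rule prod_zero[OF _ bexI[of _ i]]) (use that in auto)
    then show ?thesis
      by (simp add: h_def)
  qed
  have h_le: "cmod (h n x) \<le> B" for n x
    using mult_mono[OF cutoff(2)[of n x] clamp_le[of "G n x"]] cutoff(1)[of n x] by (simp add: h_def norm_mult)
  \<comment> \<open>The exceptional null set: failure of convergence, together with hyperplanes
    containing the faces, where the cutoff does not tend to 1.\<close>
  define Z where "Z = N \<union> (\<Union>i. {x. x$i = 0}) \<union> (\<Union>i. {x. x$i = 2 * pi})"
  have "negligible {x::real^'d. x$i = c}" for i c
    using negligible_standard_hyperplane[of "axis i 1 :: real^'d" c] by (simp add: inner_axis)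
  then have "negligible Z"
    unfolding Z_def by (intro negligible_Un N negligible_Union) auto
  have lim': "(\<lambda>n. h n x) \<longlonglongrightarrow> f x" if "x \<in> cube" "x \<notin> Z" for x
  proof -
    have "(\<lambda>n. min 1 (real n * max 0 (x$i * (2 * pi - x$i)))) \<longlonglongrightarrow> 1" for i
    proof -
      have "x$i > 0" "2 * pi - x$i > 0"
        using that by (auto simp: Z_def cube_def less_le)
      then have pos: "x$i * (2 * pi - x$i) > 0"
        by (rule mult_pos_pos)
      then obtain M where M: "1 \<le> real M * (x$i * (2 * pi - x$i))"
        using reals_Archimedean3[OF pos] less_imp_le by metis
      have "min 1 (real n * max 0 (x$i * (2 * pi - x$i))) = 1" if "n \<ge> M" for n
      proof -
        have "real M * (x$i * (2 * pi - x$i)) \<le> real n * (x$i * (2 * pi - x$i))"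
          using that pos by (intro mult_right_mono) auto
        with M pos show ?thesis
          by (simp add: max_def min_def)
      qed
      then show ?thesis
        by (intro tendsto_eventually) (auto simp: eventually_sequentially)
    qed
    then have "(\<lambda>n. cutoff n x) \<longlonglongrightarrow> (\<Prod>i::'d\<in>UNIV. 1)"
      unfolding cutoff_def by (intro tendsto_prod)
    moreover have "(\<lambda>n. clamp (G n x)) \<longlonglongrightarrow> clamp (f x)"
      using lim[of x] that cont_clamp[of UNIV]
      by (intro continuous_on_tendsto_compose[OF cont_clamp[of UNIV]]) (auto simp: Z_def)
    ultimately have "(\<lambda>n. h n x) \<longlonglongrightarrow> of_real (\<Prod>i::'d\<in>UNIV. 1) * clamp (f x)"
      unfolding h_def by (intro tendsto_intros)
    then show ?thesis
      by (simp add: clamp_eq B)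
  qed
  have "(\<lambda>n. mass (\<lambda>x. f x - h n x)) \<longlonglongrightarrow> 0"
  proof (rule mass_dominated_convergence[OF f])
    show "h n \<in> borel_measurable torus" for n
      by (intro torus_measurable_continuous continuous_on_subset[OF cont] subset_UNIV)
    show "integrable torus (\<lambda>x::real^'d. (2 * B)^2)"
      by (intro torus_integrable_continuous continuous_intros)
    show "(cmod (f x - h n x))^2 \<le> (2 * B)^2" for n x
      using norm_triangle_ineq4[of "f x" "h n x"] B[of x] h_le[of n x] by (intro power_mono) auto
    have "AE x in lebesgue. x \<notin> Z"
      using \<open>negligible Z\<close> by (simp add: negligible_iff_null_sets AE_not_in)
    then show "AE x in torus. (\<lambda>n. h n x) \<longlonglongrightarrow> f x"
      by (subst AE_restrict_space_iff) (auto simp: cube_lmeasurable fmeasurableD lim' elim!: eventually_mono)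
  qed
  then have "\<forall>\<^sub>F n in sequentially. mass (\<lambda>x. f x - h n x) < e"
    using \<open>e > 0\<close> by (rule order_tendstoD)
  then obtain n where "mass (\<lambda>x. f x - h n x) < e"
    by (auto simp: eventually_sequentially)
  then show ?thesis
    using that cont zero by blast
qed

theorem trig_poly_dense_L2:
  fixes f :: "real^'d::finite \<Rightarrow> complex"
  assumes f: "square_integrable f" and "e > 0"
  obtains p where "trig_poly p" "mass (\<lambda>x. f x - p x) < e"
proof -
  define L :: real where "L = (2 * pi) ^ CARD('d)"
  have L: "L > 0"
    by (simp add: L_def)
  \<comment> \<open>The tolerances fit two uses of \<open>mass_triangle\<close>: the errors
    \<open>e / 16\<close> from \<open>g\<close> to \<open>h\<close> and from \<open>h\<close> to
    \<open>p\<close> combine to less than \<open>e / 4\<close>, and this with \<open>e / 4\<close>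
    from \<open>f\<close> to \<open>g\<close> gives less than \<open>e\<close>.\<close>
  define \<eta> where "\<eta> = sqrt (e / (16 * L))"
  have \<eta>: "\<eta> > 0" "L * \<eta>^2 = e / 16"
    using L \<open>e > 0\<close> by (auto simp: \<eta>_def)
  have e: "e / 4 > 0" "e / 16 > 0"
    using \<open>e > 0\<close> by auto
  obtain B g where g: "g \<in> borel_measurable torus" "\<And>x. cmod (g x) \<le> B" "mass (\<lambda>x. f x - g x) < e / 4"
    using bounded_dense[OF f e(1)] by blast
  obtain h where h: "continuous_on UNIV h" "\<And>x i. x$i = 0 \<or> x$i = 2 * pi \<Longrightarrow> h x = 0"
    "mass (\<lambda>x. g x - h x) < e / 16"
    by (rule continuous_dense[OF g(1,2) e(2)]) blast
  \<comment> \<open>Distinct points of the cube with the same image differ in a coordinate by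
    exactly one period. Both then lie on faces, where \<open>h\<close> is 0.\<close>
  have glue: "h x = h y" if "x \<in> cube" "y \<in> cube" "\<And>i. cis (x$i) = cis (y$i)" for x y
  proof (cases "x = y")
    case False
    then obtain i where i: "x$i \<noteq> y$i"
      by (auto simp: vec_eq_iff)
    have "sin (x$i) = sin (y$i) \<and> cos (x$i) = cos (y$i)"
      using that(3)[of i] by (auto simp: complex_eq_iff)
    then obtain n :: int where n: "x$i = y$i + 2 * pi * n"
      using sin_cos_eq_iff by blast
    have b: "0 \<le> x$i" "x$i \<le> 2 * pi" "0 \<le> y$i" "y$i \<le> 2 * pi"
      using that by (auto simp: cube_def)
    have "\<bar>2 * pi * n\<bar> \<le> 2 * pi * 1"
      using n b by auto
    then have "\<bar>real_of_int n\<bar> \<le> 1"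
      by (simp add: abs_mult)
    then have "n = -1 \<or> n = 0 \<or> n = 1"
      by linarith
    then have "(x$i = 0 \<or> x$i = 2 * pi) \<and> (y$i = 0 \<or> y$i = 2 * pi)"
      using n b i by auto
    then show ?thesis
      using h(2) by metis
  qed simp
  obtain p where p: "trig_poly p" "\<And>x. x \<in> cube \<Longrightarrow> cmod (h x - p x) < \<eta>"
    using trig_poly_dense[OF continuous_on_subset[OF h(1) subset_UNIV] glue \<eta>(1)] by blast
  have sq: "square_integrable g" "square_integrable h" "square_integrable p"
    using g(1,2) h(1) p(1)
    by (auto intro: square_integrable_bounded square_integrable_continuous trig_poly_continuous continuous_on_subset)
  have "mass (\<lambda>x. h x - p x) \<le> e / 16"
    using mass_uniform_bound[of "\<lambda>x. h x - p x" \<eta>] p(2) \<eta>(2) sq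
    by (simp add: L_def less_imp_le square_integrable_diff)
  moreover have "mass (\<lambda>x. g x - p x) \<le> 2 * mass (\<lambda>x. g x - h x) + 2 * mass (\<lambda>x. h x - p x)"
    by (rule mass_triangle[OF sq])
  moreover have "mass (\<lambda>x. f x - p x) \<le> 2 * mass (\<lambda>x. f x - g x) + 2 * mass (\<lambda>x. g x - p x)"
    by (rule mass_triangle[OF f sq(1) sq(3)])
  ultimately have "mass (\<lambda>x. f x - p x) < e"
    using g(3) h(3) by linarith
  with p(1) show ?thesis
    using that by blast
qed

text \<open>The completeness half of Parseval, the direction that the Poincare inequality uses.
  Approximate \<open>f\<close> by a trigonometric polynomial; the best approximation with the same
  frequencies is at least as close.\<close>

theorem mass_le_sum_fcoeff:
  fixes f :: "real^'d::finite \<Rightarrow> complex"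
  assumes f: "square_integrable f" and sum: "(\<lambda>m. (cmod (fcoeff f m))^2) summable_on UNIV"
  shows "mass f \<le> (\<Sum>\<^sub>\<infinity>m. (cmod (fcoeff f m))^2) / (2 * pi) ^ CARD('d)"
proof (rule field_le_epsilon)
  fix e :: real assume "e > 0"
  then obtain p where p: "trig_poly p" "mass (\<lambda>x. f x - p x) < e"
    using trig_poly_dense_L2[OF f] by blast
  obtain F c where F: "finite F" "p = (\<lambda>x. \<Sum>m\<in>F. c m * torus_exp m x)"
    using trig_poly_expansion[OF p(1)] .
  have "mass f - (\<Sum>m\<in>F. (cmod (fcoeff f m))^2) / (2 * pi) ^ CARD('d) < e"
    using best_approximation[OF f F(1), of c] p(2) unfolding F(2) by linarith
  moreover have "(\<Sum>m\<in>F. (cmod (fcoeff f m))^2) \<le> (\<Sum>\<^sub>\<infinity>m. (cmod (fcoeff f m))^2)"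
    by (rule finite_sum_le_infsum[OF sum F(1)]) auto
  then have "(\<Sum>m\<in>F. (cmod (fcoeff f m))^2) / (2 * pi) ^ CARD('d)
      \<le> (\<Sum>\<^sub>\<infinity>m. (cmod (fcoeff f m))^2) / (2 * pi) ^ CARD('d)"
    by (rule divide_right_mono) simp
  ultimately show "mass f \<le> (\<Sum>\<^sub>\<infinity>m. (cmod (fcoeff f m))^2) / (2 * pi) ^ CARD('d) + e"
    by linarith
qed

section \<open>Convolution forms\<close>

text \<open>A shift multiplies a character by a constant and a reflection negates its frequency. For
  nonzero frequency all the integrals vanish, and for frequency zero the function is
  constant.\<close>

lemma trig_poly_torus_int_translate:
  fixes p :: "real^'d::finite \<Rightarrow> complex"
  assumes "trig_poly p"
  shows "torus_int (\<lambda>x. p (t + x)) = torus_int p \<and> torus_int (\<lambda>x. p (t - x)) = torus_int p"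
  using assms
proof (induction rule: trig_poly.induct)
  case (monomial c m)
  have "torus_int (\<lambda>x. c * torus_exp m (t + x)) = c * torus_exp m t * torus_int (torus_exp m :: real^'d \<Rightarrow> complex)"
    "torus_int (\<lambda>x. c * torus_exp m (t - x)) = c * torus_exp m t * torus_int (torus_exp (- m) :: real^'d \<Rightarrow> complex)"
    "torus_int (\<lambda>x. c * torus_exp m x) = c * torus_int (torus_exp m :: real^'d \<Rightarrow> complex)"
    unfolding torus_int_def diff_conv_add_uminus torus_exp_translate torus_exp_reflect mult.assoc[symmetric]
    by (rule integral_mult_right_zero)+
  then show ?case
    by (simp add: torus_int_torus_exp)
next
  case (add p q)
  have int: "integrable torus (\<lambda>x. r (\<phi> x))"
    if "trig_poly r" "continuous_on UNIV \<phi>" for r and \<phi> :: "real^'d \<Rightarrow> real^'d"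
    by (intro torus_integrable_continuous continuous_on_compose2[OF trig_poly_continuous[OF that(1), of UNIV]]
        continuous_on_subset[OF that(2)] subset_UNIV)
  have "integrable torus (\<lambda>x. p (t + x))" "integrable torus (\<lambda>x. p (t - x))"
    "integrable torus (\<lambda>x. q (t + x))" "integrable torus (\<lambda>x. q (t - x))"
    "integrable torus p" "integrable torus q"
    by (intro add.hyps int[of p "(+) t"] int[of p "(-) t"] int[of q "(+) t"] int[of q "(-) t"]
        int[of p "\<lambda>x. x"] int[of q "\<lambda>x. x"] continuous_intros)+
  then show ?case
    using add.IH by (simp add: torus_int_def)
qed

lemma torus_int_diff_le:
  fixes f g :: "real^'d::finite \<Rightarrow> complex"
  assumes "continuous_on cube f" "continuous_on cube g" "\<And>x. x \<in> cube \<Longrightarrow> cmod (f x - g x) \<le> e"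
  shows "cmod (torus_int f - torus_int g) \<le> (2 * pi) ^ CARD('d) * e"
proof -
  have "torus_int f - torus_int g = torus_int (\<lambda>x. f x - g x)"
    unfolding torus_int_def
    by (rule Bochner_Integration.integral_diff[symmetric]) (intro torus_integrable_continuous assms)+
  also have "cmod \<dots> \<le> torus_int (\<lambda>x. cmod (f x - g x))"
    unfolding torus_int_def by (rule integral_norm_bound)
  also have "\<dots> \<le> torus_int (\<lambda>x::real^'d. e)"
    unfolding torus_int_def using assms
    by (intro integral_mono torus_integrable_continuous continuous_intros) auto
  also have "\<dots> = (2 * pi) ^ CARD('d) * e"
    using measure_torus[where 'd = 'd] by (simp add: torus_int_def)
  finally show ?thesis .
qed

lemma torus_int_translate_complex:
  fixes f :: "real^'d::finite \<Rightarrow> complex"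
  assumes cont: "continuous_on UNIV f" and per: "periodic_torus f"
  shows "torus_int (\<lambda>x. f (t + x)) = torus_int f" "torus_int (\<lambda>x. f (t - x)) = torus_int f"
proof -
  define L :: real where "L = (2 * pi) ^ CARD('d)"
  have L: "L > 0"
    by (simp add: L_def)
  \<comment> \<open>Here \<open>\<phi>\<close> stands for both changes of variable. Invariance is
    assumed for trigonometric polynomials only and passes to \<open>f\<close> by uniform
    approximation, each of the two integrals costing at most \<open>e / 2\<close>.\<close>
  have *: "torus_int (\<lambda>x. f (\<phi> x)) = torus_int f"
    if \<phi>: "continuous_on UNIV \<phi>" "\<And>p. trig_poly p \<Longrightarrow> torus_int (\<lambda>x. p (\<phi> x)) = torus_int p"
    for \<phi> :: "real^'d \<Rightarrow> real^'d"
  proof -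
    have "cmod (torus_int (\<lambda>x. f (\<phi> x)) - torus_int f) \<le> 0 + e" if "e > 0" for e
    proof -
      have "e / (2 * L) > 0"
        using that L by simp
      from trig_poly_dense_periodic[OF cont per this]
      obtain p where p: "trig_poly p" "\<And>x. cmod (f x - p x) < e / (2 * L)"
        by blast
      have cp: "continuous_on UNIV p"
        by (rule trig_poly_continuous[OF p(1)])
      have "cmod (torus_int (\<lambda>x. f (\<phi> x)) - torus_int (\<lambda>x. p (\<phi> x))) \<le> L * (e / (2 * L))"
        unfolding L_def
        by (intro torus_int_diff_le continuous_on_compose2[OF cont] continuous_on_compose2[OF cp]
              continuous_on_subset[OF \<phi>(1)] subset_UNIV less_imp_le[OF p(2)[unfolded L_def]])
      moreover have "cmod (torus_int f - torus_int p) \<le> L * (e / (2 * L))"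
        unfolding L_def
        by (intro torus_int_diff_le continuous_on_subset[OF cont] continuous_on_subset[OF cp]
              subset_UNIV less_imp_le[OF p(2)[unfolded L_def]])
      moreover have "L * (e / (2 * L)) = e / 2"
        using L by simp
      ultimately show ?thesis
        using norm_triangle_ineq4[of "torus_int (\<lambda>x. f (\<phi> x)) - torus_int p" "torus_int f - torus_int p"] \<phi>(2)[OF p(1)]
        by simp
    qed
    then have "cmod (torus_int (\<lambda>x. f (\<phi> x)) - torus_int f) \<le> 0"
      by (rule field_le_epsilon)
    then show ?thesis
      by simp
  qed
  show "torus_int (\<lambda>x. f (t + x)) = torus_int f" "torus_int (\<lambda>x. f (t - x)) = torus_int f"
    using trig_poly_torus_int_translate by (intro *; force intro!: continuous_intros)+
qed

lemma torus_int_of_real: "torus_int (\<lambda>x. complex_of_real (f x)) = of_real (torus_int f)"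
  by (simp add: torus_int_def)

lemma torus_int_translate:
  fixes f :: "real^'d::finite \<Rightarrow> real"
  assumes "continuous_on UNIV f" "periodic_torus f"
  shows "torus_int (\<lambda>x. f (x - t)) = torus_int f" "torus_int (\<lambda>x. f (t - x)) = torus_int f"
proof -
  have "continuous_on UNIV (\<lambda>x. complex_of_real (f x))" "periodic_torus (\<lambda>x. complex_of_real (f x))"
    using assms by (auto simp: periodic_torus_def intro: continuous_intros)
  from torus_int_translate_complex(1)[OF this, of "- t"] torus_int_translate_complex(2)[OF this, of t]
  show "torus_int (\<lambda>x. f (x - t)) = torus_int f" "torus_int (\<lambda>x. f (t - x)) = torus_int f"
    by (simp_all add: torus_int_of_real)
qed

lemma periodic_continuous_bounded:
  fixes f :: "real^'d::finite \<Rightarrow> real"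
  assumes "continuous_on UNIV f" "periodic_torus f"
  obtains S where "S \<ge> 0" "\<And>x. \<bar>f x\<bar> \<le> S"
proof -
  have "bounded (f ` cube)"
    by (intro compact_imp_bounded compact_continuous_image compact_cube continuous_on_subset[OF assms(1)] subset_UNIV)
  then obtain S where S: "S > 0" "\<And>x. x \<in> cube \<Longrightarrow> \<bar>f x\<bar> \<le> S"
    unfolding bounded_pos by auto
  have "\<bar>f x\<bar> \<le> S" for x
    using periodic_torus_representative[of x, where 'b = real] assms(2) S(2) by metis
  with S(1) show ?thesis
    using that less_imp_le by blast
qed

section \<open>Bilinear convolution forms and Schur's test\<close>

lemma pair_sigma_finite_torus:
  "pair_sigma_finite (torus :: (real^'d::finite) measure) (torus :: (real^'d) measure)"
proof -
  interpret finite_measure "torus :: (real^'d) measure"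
    by (rule finite_measure_torus)
  show ?thesis ..
qed

lemma measurable_convolution_kernel:
  fixes K :: "real^'d::finite \<Rightarrow> real"
  assumes K: "continuous_on UNIV K"
  shows "(\<lambda>(x, y). K (x - y)) \<in> borel_measurable (torus \<Otimes>\<^sub>M torus)"
proof -
  have [measurable]: "K \<in> borel_measurable borel"
    by (rule borel_measurable_continuous_onI[OF K])
  \<comment> \<open>\<open>torus\<close> carries the Lebesgue sets while \<open>K\<close> is Borel;
    the identity, measurable into the Borel sets, bridges the two.\<close>
  have [measurable]: "(\<lambda>x::real^'d. x) \<in> borel_measurable torus"
    using id_borel_measurable_lebesgue_on[of cube] by (simp add: id_def)
  show ?thesis
    by measurable
qed

lemma integrable_convolution_kernel:
  fixes K g h :: "real^'d::finite \<Rightarrow> real"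
  assumes K: "continuous_on UNIV K" and S: "\<And>x. \<bar>K x\<bar> \<le> S"
    and g: "integrable torus g" and h: "integrable torus h"
  shows "integrable (torus \<Otimes>\<^sub>M torus) (\<lambda>(x, y). K (x - y) * g y * h x)"
proof -
  interpret pair_sigma_finite "torus :: (real^'d) measure" "torus :: (real^'d) measure"
    by (rule pair_sigma_finite_torus)
  have [measurable]: "g \<in> borel_measurable torus" "h \<in> borel_measurable torus"
    using g h by auto
  have [measurable]: "(\<lambda>p. K (fst p - snd p)) \<in> borel_measurable (torus \<Otimes>\<^sub>M torus)"
    using measurable_convolution_kernel[OF K] by (simp add: case_prod_beta')
  have prod: "integrable (torus \<Otimes>\<^sub>M torus) (\<lambda>p. S * (\<bar>g (snd p)\<bar> * \<bar>h (fst p)\<bar>))"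
  proof (intro integrable_mult_right Fubini_integrable)
    show "AE x in torus. integrable torus (\<lambda>y. \<bar>g (snd (x, y))\<bar> * \<bar>h (fst (x, y))\<bar>)"
      using g by (intro AE_I2) simp
    show "integrable torus (\<lambda>x. LINT y|torus. norm (\<bar>g (snd (x, y))\<bar> * \<bar>h (fst (x, y))\<bar>))"
      using h by simp
  qed measurable
  show ?thesis
  proof (rule Bochner_Integration.integrable_bound[OF prod])
    show "(\<lambda>(x, y). K (x - y) * g y * h x) \<in> borel_measurable (torus \<Otimes>\<^sub>M torus)"
      unfolding case_prod_beta' by measurable
    have "\<bar>K (fst p - snd p)\<bar> * \<bar>g (snd p)\<bar> * \<bar>h (fst p)\<bar> \<le> S * (\<bar>g (snd p)\<bar> * \<bar>h (fst p)\<bar>)" for p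
      using mult_right_mono[OF S, of "\<bar>g (snd p)\<bar> * \<bar>h (fst p)\<bar>"] by (simp add: mult.assoc)
    moreover have "S \<ge> 0"
      using S[of 0] by linarith
    ultimately show "AE p in torus \<Otimes>\<^sub>M torus. norm (case p of (x, y) \<Rightarrow> K (x - y) * g y * h x)
        \<le> norm (S * (\<bar>g (snd p)\<bar> * \<bar>h (fst p)\<bar>))"
      by (intro AE_I2) (auto simp: abs_mult)
  qed
qed

text \<open>For \<open>K = Sigma \<sigma>1\<close> and both arguments equal to the density of
  \<open>u\<close>, this is the interaction integral in \<open>energy\<close>.\<close>

definition conv_form :: "(real^'d::finite \<Rightarrow> real) \<Rightarrow> (real^'d \<Rightarrow> real) \<Rightarrow> (real^'d \<Rightarrow> real) \<Rightarrow> real" where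
  "conv_form K g h = torus_int (\<lambda>x. torus_conv K g x * h x)"

text \<open>\<open>S\<close> is a sup bound, used for the higher-order terms. \<open>A\<close> is
  the common value of the row and column integrals, that is, the constant in Schur's test.\<close>

locale torus_kernel =
  fixes K :: "real^'d::finite \<Rightarrow> real" and S A :: real
  assumes cont: "continuous_on UNIV K"
    and bound: "\<And>x. \<bar>K x\<bar> \<le> S"
    and nonneg: "\<And>x. K x \<ge> 0"
    and mean_left: "\<And>y. torus_int (\<lambda>x. K (x - y)) = A"
    and mean_right: "\<And>x. torus_int (\<lambda>y. K (x - y)) = A"
begin

lemma bound_nonneg: "S \<ge> 0"
  using bound[of 0] by linarith

lemma int_kernel:
  "integrable torus g \<Longrightarrow> integrable torus h \<Longrightarrow>
    integrable (torus \<Otimes>\<^sub>M torus) (\<lambda>(x, y). K (x - y) * g y * h x)"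
  by (rule integrable_convolution_kernel[OF cont bound])

lemma conv_form_eq:
  assumes "integrable torus g" "integrable torus h"
  shows "conv_form K g h = integral\<^sup>L (torus \<Otimes>\<^sub>M torus) (\<lambda>p. K (fst p - snd p) * g (snd p) * h (fst p))"
proof -
  interpret pair_sigma_finite "torus :: (real^'d) measure" "torus :: (real^'d) measure"
    by (rule pair_sigma_finite_torus)
  show ?thesis
    using integral_fst[OF int_kernel[OF assms]]
    by (simp add: conv_form_def torus_conv_def torus_int_def case_prod_beta')
qed

lemma conv_form_swap:
  assumes "integrable torus g" "integrable torus h"
  shows "conv_form K g h = torus_int (\<lambda>y. g y * torus_int (\<lambda>x. K (x - y) * h x))"
proof -
  interpret pair_sigma_finite "torus :: (real^'d) measure" "torus :: (real^'d) measure"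
    by (rule pair_sigma_finite_torus)
  have "(\<lambda>y. LINT x|torus. K (x - y) * g y * h x) = (\<lambda>y. g y * (LINT x|torus. K (x - y) * h x))"
    by (simp add: mult_ac flip: integral_mult_right_zero)
  then show ?thesis
    using integral_snd[OF int_kernel[OF assms]] conv_form_eq[OF assms]
    by (simp add: torus_int_def case_prod_beta')
qed

lemma conv_form_add_left:
  assumes "integrable torus f" "integrable torus g" "integrable torus h"
  shows "conv_form K (\<lambda>x. f x + g x) h = conv_form K f h + conv_form K g h"
  using assms int_kernel[of f h] int_kernel[of g h]
  by (simp add: conv_form_eq case_prod_beta' algebra_simps)

lemma conv_form_add_right:
  assumes "integrable torus f" "integrable torus g" "integrable torus h"
  shows "conv_form K f (\<lambda>x. g x + h x) = conv_form K f g + conv_form K f h"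
  using assms int_kernel[of f g] int_kernel[of f h]
  by (simp add: conv_form_eq case_prod_beta' algebra_simps)

lemma conv_form_const_left:
  assumes "integrable torus h"
  shows "conv_form K (\<lambda>_. c) h = A * c * torus_int h"
  unfolding conv_form_def torus_conv_def
  using mean_right by (simp add: torus_int_def)

lemma conv_form_const_right:
  assumes g: "integrable torus g"
  shows "conv_form K g (\<lambda>_. c) = A * c * torus_int g"
proof -
  have "integrable (torus :: (real^'d) measure) (\<lambda>_. c)"
    by (intro torus_integrable_continuous continuous_intros)
  then show ?thesis
    using mean_left by (simp add: conv_form_swap[OF g] torus_int_def)
qed

lemma conv_form_le_L1:
  assumes g: "integrable torus g" and h: "integrable torus h"
  shows "\<bar>conv_form K g h\<bar> \<le> S * torus_int (\<lambda>x. \<bar>g x\<bar>) * torus_int (\<lambda>x. \<bar>h x\<bar>)"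
proof -
  interpret pair_sigma_finite "torus :: (real^'d) measure" "torus :: (real^'d) measure"
    by (rule pair_sigma_finite_torus)
  \<comment> \<open>Integrability of the dominating function is the case of the constant kernel
    \<open>S\<close>.\<close>
  have int: "integrable (torus \<Otimes>\<^sub>M torus) (\<lambda>(x::real^'d, y). S * \<bar>g y\<bar> * \<bar>h x\<bar>)"
    using g h bound_nonneg by (intro integrable_convolution_kernel[of "\<lambda>_. S" S]) auto
  have "\<bar>conv_form K g h\<bar> \<le> integral\<^sup>L (torus \<Otimes>\<^sub>M torus) (\<lambda>p. norm (K (fst p - snd p) * g (snd p) * h (fst p)))"
    unfolding conv_form_eq[OF g h] real_norm_def[symmetric] by (rule integral_norm_bound)
  also have "\<dots> \<le> integral\<^sup>L (torus \<Otimes>\<^sub>M torus) (\<lambda>p. S * \<bar>g (snd p)\<bar> * \<bar>h (fst p)\<bar>)"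
    using int int_kernel[OF g h] bound
    by (intro integral_mono integrable_norm) (auto simp: case_prod_beta' abs_mult intro!: mult_right_mono)
  also have "\<dots> = S * torus_int (\<lambda>x. \<bar>g x\<bar>) * torus_int (\<lambda>x. \<bar>h x\<bar>)"
    using integral_fst[OF int] by (simp add: torus_int_def case_prod_beta')
  finally show ?thesis .
qed

text \<open>Schur's test for a nonnegative kernel: bound the product \<open>g x * g y\<close> by the
  mean of the two squares, then integrate out the other variable. This keeps the sharp constant
  \<open>A\<close> instead of \<open>S\<close>.\<close>

lemma conv_form_le_L2:
  assumes g: "integrable torus g" and g2: "integrable torus (\<lambda>x. (g x)^2)"
  shows "\<bar>conv_form K g g\<bar> \<le> A * torus_int (\<lambda>x. (g x)^2)"
proof -
  \<comment> \<open>The weight \<open>1 / 2\<close> is treated as a constant function, so that both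
    halves of the bound are again convolution forms with one constant argument.\<close>
  have one: "integrable (torus :: (real^'d) measure) (\<lambda>_. 1 / 2 :: real)"
    by (intro torus_integrable_continuous continuous_intros)
  note int = int_kernel[OF g2 one] int_kernel[OF one g2]
  have "\<bar>conv_form K g g\<bar> \<le> integral\<^sup>L (torus \<Otimes>\<^sub>M torus) (\<lambda>p. norm (K (fst p - snd p) * g (snd p) * g (fst p)))"
    unfolding conv_form_eq[OF g g] real_norm_def[symmetric] by (rule integral_norm_bound)
  also have "\<dots> \<le> integral\<^sup>L (torus \<Otimes>\<^sub>M torus) (\<lambda>p. K (fst p - snd p) * (g (snd p))^2 * (1 / 2)
      + K (fst p - snd p) * (1 / 2) * (g (fst p))^2)"
  proof (intro integral_mono integrable_norm Bochner_Integration.integrable_add)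
    fix p :: "(real^'d) \<times> (real^'d)"
    have "\<bar>g (snd p) * g (fst p)\<bar> \<le> (g (snd p))^2 / 2 + (g (fst p))^2 / 2"
      using sum_squares_bound[of "\<bar>g (snd p)\<bar>" "\<bar>g (fst p)\<bar>"] by (simp add: abs_mult)
    from mult_left_mono[OF this nonneg[of "fst p - snd p"]]
    show "norm (K (fst p - snd p) * g (snd p) * g (fst p)) \<le> K (fst p - snd p) * (g (snd p))^2 * (1 / 2)
        + K (fst p - snd p) * (1 / 2) * (g (fst p))^2"
      using nonneg[of "fst p - snd p"] by (simp add: abs_mult algebra_simps)
  qed (use int int_kernel[OF g g] in \<open>simp_all add: case_prod_beta'\<close>)
  also have "\<dots> = conv_form K (\<lambda>x. (g x)^2) (\<lambda>_. 1 / 2) + conv_form K (\<lambda>_. 1 / 2) (\<lambda>x. (g x)^2)"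
    unfolding conv_form_eq[OF g2 one] conv_form_eq[OF one g2]
    by (rule Bochner_Integration.integral_add) (use int in \<open>simp_all add: case_prod_beta'\<close>)
  also have "\<dots> = A * torus_int (\<lambda>x. (g x)^2)"
    by (simp add: conv_form_const_left[OF g2] conv_form_const_right[OF g2])
  finally show ?thesis .
qed

end

lemma continuous_torus_conv:
  fixes f g :: "real^'d::finite \<Rightarrow> real"
  assumes f: "continuous_on UNIV f" and S: "\<And>x. \<bar>f x\<bar> \<le> S" and g: "integrable torus g"
  shows "continuous_on UNIV (torus_conv f g)"
proof -
  have [measurable]: "f \<in> borel_measurable borel" "g \<in> borel_measurable torus"
    using f g by (auto intro: borel_measurable_continuous_onI)
  have [measurable]: "(\<lambda>x::real^'d. x) \<in> borel_measurable torus"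
    using id_borel_measurable_lebesgue_on[of cube] by (simp add: id_def)
  have "(\<lambda>n. torus_conv f g (X n)) \<longlonglongrightarrow> torus_conv f g x" if "X \<longlonglongrightarrow> x" for X x
    unfolding torus_conv_def torus_int_def
  proof (rule integral_dominated_convergence)
    show "integrable torus (\<lambda>y. S * \<bar>g y\<bar>)"
      using g by simp
    show "AE y in torus. norm (f (X n - y) * g y) \<le> S * \<bar>g y\<bar>" for n
      by (intro AE_I2) (auto simp: abs_mult intro!: mult_right_mono S)
    have "(\<lambda>n. f (X n - y) * g y) \<longlonglongrightarrow> f (x - y) * g y" for y
      by (intro tendsto_intros continuous_on_tendsto_compose[OF f] that) auto
    then show "AE y in torus. (\<lambda>n. f (X n - y) * g y) \<longlonglongrightarrow> f (x - y) * g y"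
      by simp
  qed measurable
  then show ?thesis
    by (auto simp: continuous_on_sequentially o_def)
qed

text \<open>Fubini and translation invariance of the integral of \<open>\<sigma>\<close> give the
  total integral of \<open>Sigma \<sigma>\<close>; invariance for \<open>Sigma \<sigma>\<close>
  itself then gives all row and column integrals.\<close>

lemma torus_kernel_Sigma:
  fixes \<sigma> :: "real^'d::finite \<Rightarrow> real"
  assumes cont: "continuous_on UNIV \<sigma>" and per: "periodic_torus \<sigma>" and nonneg: "\<And>x. \<sigma> x \<ge> 0"
  obtains S where "torus_kernel (Sigma \<sigma>) S ((torus_int \<sigma>)^2)"
proof -
  interpret pair_sigma_finite "torus :: (real^'d) measure" "torus :: (real^'d) measure"
    by (rule pair_sigma_finite_torus)
  obtain B where B: "\<And>x. \<bar>\<sigma> x\<bar> \<le> B"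
    using periodic_continuous_bounded[OF cont per] by blast
  have int: "integrable torus \<sigma>"
    by (intro torus_integrable_continuous continuous_on_subset[OF cont] subset_UNIV)
  have contS: "continuous_on UNIV (Sigma \<sigma>)"
    unfolding Sigma_def by (rule continuous_torus_conv[OF cont B int])
  have perS: "periodic_torus (Sigma \<sigma>)"
  proof -
    have "\<sigma> (x + (2 * pi) *\<^sub>R axis i 1 - y) = \<sigma> (x - y)" for x y i
      using per by (metis periodic_torus_def diff_add_eq)
    then show ?thesis
      by (simp add: periodic_torus_def Sigma_def torus_conv_def)
  qed
  obtain S where S: "\<And>x. \<bar>Sigma \<sigma> x\<bar> \<le> S"
    using periodic_continuous_bounded[OF contS perS] by blast
  have "torus_int (Sigma \<sigma>) = (LINT y|torus. LINT x|torus. \<sigma> (x - y) * \<sigma> y)"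
    unfolding Sigma_def torus_conv_def[abs_def] torus_int_def
    using Fubini_integral[of "\<lambda>x y. \<sigma> (x - y) * \<sigma> y"] integrable_convolution_kernel[OF cont B int, of "\<lambda>_. 1"]
    by (simp add: torus_integrable_continuous)
  also have "\<dots> = (LINT y|torus. torus_int \<sigma> * \<sigma> y)"
    using torus_int_translate(1)[OF cont per] by (simp add: torus_int_def)
  also have "\<dots> = (torus_int \<sigma>)^2"
    by (simp add: torus_int_def power2_eq_square)
  finally have mean: "torus_int (Sigma \<sigma>) = (torus_int \<sigma>)^2" .
  have "torus_kernel (Sigma \<sigma>) S ((torus_int \<sigma>)^2)"
  proof
    show "Sigma \<sigma> x \<ge> 0" for x
      unfolding Sigma_def torus_conv_def torus_int_def
      by (intro Bochner_Integration.integral_nonneg mult_nonneg_nonneg nonneg)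
  qed (simp_all add: contS S torus_int_translate[OF contS perS] mean)
  then show ?thesis
    by (rule that)
qed

section \<open>The interaction energy near a constant\<close>

lemma fcoeff_0: "fcoeff f 0 = torus_int f"
  by (simp add: fcoeff_eq)

lemma mass_const: "mass (\<lambda>x::real^'d::finite. c) = (2 * pi) ^ CARD('d) * (cmod c)^2"
  using measure_torus[where 'd = 'd] by (simp add: mass_def torus_int_def)

text \<open>Pythagoras for the splitting of \<open>u\<close> into its mean and a mean-free
  part.\<close>

lemma mass_fluctuation:
  fixes u :: "real^'d::finite \<Rightarrow> complex"
  assumes u: "square_integrable u"
  shows "mass (\<lambda>x. u x - fcoeff u 0 / (2 * pi) ^ CARD('d))
    = mass u - (cmod (fcoeff u 0))^2 / (2 * pi) ^ CARD('d)"
proof -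
  define L :: real where "L = (2 * pi) ^ CARD('d)"
  have L: "L > 0"
    by (simp add: L_def)
  define z where "z = fcoeff u 0"
  have "torus_int (\<lambda>x. u x * cnj (z / L)) = z * cnj (z / L)"
    unfolding z_def fcoeff_0 torus_int_def by (rule integral_mult_left_zero)
  also have "\<dots> = of_real ((cmod z)^2 / L)"
    by (simp add: complex_norm_square[symmetric] del: of_real_power)
  finally have "mass (\<lambda>x. u x - z / L) = mass u - 2 * ((cmod z)^2 / L) + L * (cmod (z / L))^2"
    by (simp add: mass_diff[OF u square_integrable_const] mass_const L_def)
  also have "L * (cmod (z / L))^2 = (cmod z)^2 / L"
    using L by (simp add: norm_divide power2_eq_square)
  finally show ?thesis
    by (simp add: z_def L_def)
qed

text \<open>Write \<open>u = z + w\<close> with mean \<open>z\<close>, so that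
  \<open>X = mass w\<close>. The density is \<open>\<mu> + g + h\<close>, with \<open>g\<close>
  linear in \<open>w\<close> and \<open>h\<close> quadratic, both of mean zero; hence
  \<open>\<mu>\<close> decouples and yields the subtracted term. Schur's test handles the pair
  \<open>g\<close>, \<open>g\<close>, while pairs containing \<open>h\<close> are of higher order
  and the sup bound \<open>S\<close> suffices.\<close>

lemma (in torus_kernel) conv_form_density_bound:
  fixes u :: "real^'d \<Rightarrow> complex"
  defines "L \<equiv> (2 * pi) ^ CARD('d)" and "\<rho> \<equiv> \<lambda>x. (cmod (u x))^2" and "c \<equiv> cmod (fcoeff u 0 / (2 * pi) ^ CARD('d))"
    and "X \<equiv> mass u - (cmod (fcoeff u 0))^2 / (2 * pi) ^ CARD('d)"
  assumes u: "square_integrable u" and lam: "0 < r" "r \<le> 1" and X: "X \<le> r^2"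
  shows "\<bar>conv_form K \<rho> \<rho> - A * (mass u)^2 / L\<bar> \<le> X * (4 * A * c^2 + 4 * S * (L + 1) * r * (c + 1))"
proof -
  have L: "L > 0"
    by (simp add: L_def)
  define z where "z = fcoeff u 0 / L"
  define w where "w x = u x - z" for x
  define \<mu> where "\<mu> = mass u / L"
  define g where "g x = 2 * Re (cnj z * w x)" for x
  \<comment> \<open>Subtracting \<open>X / L\<close> makes the quadratic part mean-free; the same
    amount is contained in \<open>\<mu>\<close>.\<close>
  define h where "h x = (cmod (w x))^2 - X / L" for x
  have c: "c = cmod z" "c \<ge> 0"
    by (simp_all add: c_def z_def L_def)
  have Xw: "mass w = X"
    using mass_fluctuation[OF u] by (simp add: w_def[abs_def] z_def L_def X_def)
  have "X \<ge> 0"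
    using Xw mass_nonneg by metis
  have massu: "mass u = L * c^2 + X"
  proof -
    have "c = cmod (fcoeff u 0) / L"
      by (simp add: c_def L_def norm_divide norm_mult norm_power)
    then show ?thesis
      using L unfolding X_def L_def[symmetric] by (simp add: power2_eq_square)
  qed
  have w: "square_integrable w"
    unfolding w_def by (intro square_integrable_diff u square_integrable_const)
  have intw2: "integrable torus (\<lambda>x. (cmod (w x))^2)"
    by (rule square_integrable_norm[OF w])
  have intw: "integrable torus w"
    by (rule square_integrable_integrable[OF w])
  have const: "integrable (torus :: (real^'d) measure) (\<lambda>_. k)" for k :: real
    by (intro torus_integrable_continuous continuous_intros)
  have torus_const: "torus_int (\<lambda>x::real^'d. k) = L * k" for k :: real
    using measure_torus[where 'd = 'd] by (simp add: torus_int_def L_def)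
  have w0: "torus_int w = 0"
  proof -
    have "torus_int w = torus_int u - torus_int (\<lambda>x::real^'d. z)"
      unfolding w_def torus_int_def
      by (rule Bochner_Integration.integral_diff) (intro square_integrable_integrable u square_integrable_const)+
    also have "\<dots> = 0"
      using L torus_int_1[where c = z and 'd = 'd] by (simp add: z_def fcoeff_0 L_def)
    finally show ?thesis .
  qed
  have intg: "integrable torus g"
    unfolding g_def using intw by (intro integrable_mult_right integrable_Re)
  have inth: "integrable torus h"
    unfolding h_def using intw2 const by (rule Bochner_Integration.integrable_diff)
  have g_le: "\<bar>g x\<bar> \<le> 2 * c * cmod (w x)" for x
    using abs_Re_le_cmod[of "cnj z * w x"] by (simp add: g_def c norm_mult abs_mult)
  have g2_le: "(g x)^2 \<le> 4 * c^2 * (cmod (w x))^2" for x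
    using power_mono[OF g_le[of x], of 2] by (simp add: power_mult_distrib)
  have intg2: "integrable torus (\<lambda>x. (g x)^2)"
  proof (rule Bochner_Integration.integrable_bound)
    show "integrable torus (\<lambda>x. 4 * c^2 * (cmod (w x))^2)"
      using intw2 by simp
    show "(\<lambda>x. (g x)^2) \<in> borel_measurable torus"
      using intg by measurable
    show "AE x in torus. norm ((g x)^2) \<le> norm (4 * c^2 * (cmod (w x))^2)"
      using g2_le by (intro AE_I2) simp
  qed
  have g0: "torus_int g = 0"
  proof -
    have "torus_int g = 2 * Re (cnj z * torus_int w)"
      unfolding g_def torus_int_def using intw
      by (subst integral_mult_right_zero, subst integral_Re) (simp_all del: times_complex.sel)
    then show ?thesis
      by (simp add: w0)
  qed
  have h0: "torus_int h = 0"
  proof -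
    have "torus_int h = mass w - torus_int (\<lambda>x::real^'d. X / L)"
      unfolding h_def torus_int_def mass_def by (rule Bochner_Integration.integral_diff[OF intw2 const])
    then show ?thesis
      using L by (simp add: torus_const Xw)
  qed
  have g2: "torus_int (\<lambda>x. (g x)^2) \<le> 4 * c^2 * X"
  proof -
    have "torus_int (\<lambda>x. (g x)^2) \<le> torus_int (\<lambda>x. 4 * c^2 * (cmod (w x))^2)"
      using intw2 by (intro torus_integral_mono intg2 g2_le) simp
    then show ?thesis
      using Xw by (simp add: torus_int_def mass_def)
  qed
  \<comment> \<open>The weighted inequality \<open>2 * a \<le> r + a^2 / r\<close> replaces
    Cauchy-Schwarz, and \<open>X \<le> r^2\<close> turns \<open>X / r\<close> into at most
    \<open>r\<close>.\<close>
  have g1: "torus_int (\<lambda>x. \<bar>g x\<bar>) \<le> c * r * (L + 1)"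
  proof -
    have "2 * cmod (w x) \<le> r + (cmod (w x))^2 / r" for x
    proof -
      have "2 * r * cmod (w x) \<le> r^2 + (cmod (w x))^2"
        by (rule sum_squares_bound)
      then show ?thesis
        using lam by (simp add: field_simps power2_eq_square)
    qed
    then have "\<bar>g x\<bar> \<le> c * (r + (cmod (w x))^2 / r)" for x
      using g_le[of x] mult_left_mono[of "2 * cmod (w x)" "r + (cmod (w x))^2 / r" c] c(2)
      by (simp add: mult_ac)
    then have "torus_int (\<lambda>x. \<bar>g x\<bar>) \<le> torus_int (\<lambda>x. c * (r + (cmod (w x))^2 / r))"
      by (intro torus_integral_mono integrable_mult_right Bochner_Integration.integrable_add integrable_divide
          integrable_abs intg intw2 const)
    also have "\<dots> = c * (L * r + X / r)"
      using intw2 const torus_const[of r] Xw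
      by (simp add: torus_int_def mass_def)
    also have "\<dots> \<le> c * (L * r + r)"
      using X lam c(2) by (intro mult_left_mono add_left_mono) (simp_all add: divide_le_eq power2_eq_square)
    finally show ?thesis
      by (simp add: algebra_simps)
  qed
  have h1: "torus_int (\<lambda>x. \<bar>h x\<bar>) \<le> 2 * X"
  proof -
    have "torus_int (\<lambda>x. \<bar>h x\<bar>) \<le> torus_int (\<lambda>x. (cmod (w x))^2 + X / L)"
      using inth intw2 const \<open>X \<ge> 0\<close> L
      by (intro torus_integral_mono Bochner_Integration.integrable_add integrable_abs)
         (auto simp: h_def abs_le_iff)
    also have "\<dots> = 2 * X"
      using intw2 const torus_const[of "X / L"] Xw L
      by (simp add: torus_int_def mass_def)
    finally show ?thesis .
  qed
  have nn: "torus_int (\<lambda>x. \<bar>g x\<bar>) \<ge> 0" "torus_int (\<lambda>x. \<bar>h x\<bar>) \<ge> 0"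
    by (simp_all add: torus_int_def)
  have \<rho>: "\<rho> = (\<lambda>x. \<mu> + (g x + h x))"
  proof
    fix x
    have "\<mu> = c^2 + X / L"
      using L by (simp add: \<mu>_def massu field_simps)
    moreover have "(cmod (z + w x))^2 = (cmod z)^2 + g x + (cmod (w x))^2"
      unfolding cmod_power2 g_def by (simp add: power2_eq_square algebra_simps)
    ultimately show "\<rho> x = \<mu> + (g x + h x)"
      by (simp add: \<rho>_def h_def c w_def)
  qed
  note intgh = Bochner_Integration.integrable_add[OF intg inth]
  have "torus_int (\<lambda>x. g x + h x) = 0"
    using intg inth g0 h0 by (simp add: torus_int_def)
  \<comment> \<open>Cross terms between \<open>\<mu>\<close> and \<open>g + h\<close> are multiples
    of the mean of \<open>g + h\<close>, hence zero.\<close>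
  then have "conv_form K \<rho> \<rho> = A * \<mu> * (L * \<mu>) + conv_form K (\<lambda>x. g x + h x) (\<lambda>x. g x + h x)"
    unfolding \<rho>
    by (simp add: conv_form_add_left[OF const intgh Bochner_Integration.integrable_add[OF const intgh]]
        conv_form_add_right[OF const const intgh] conv_form_add_right[OF intgh const intgh]
        conv_form_const_left[OF const] conv_form_const_left[OF intgh] conv_form_const_right[OF intgh] torus_const)
  also have "A * \<mu> * (L * \<mu>) = A * (mass u)^2 / L"
    using L by (simp add: \<mu>_def power2_eq_square)
  also have "conv_form K (\<lambda>x. g x + h x) (\<lambda>x. g x + h x) =
      conv_form K g g + conv_form K g h + conv_form K h g + conv_form K h h"
    by (simp add: conv_form_add_left[OF intg inth intgh] conv_form_add_right[OF _ intg inth] intg inth)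
  finally have eq: "conv_form K \<rho> \<rho> - A * (mass u)^2 / L =
      conv_form K g g + conv_form K g h + conv_form K h g + conv_form K h h"
    by simp
  have "A \<ge> 0"
    using mean_left[of 0] nonneg by (simp add: torus_int_def flip: mean_left[of 0])
  have gg: "\<bar>conv_form K g g\<bar> \<le> A * (4 * c^2 * X)"
    using conv_form_le_L2[OF intg intg2] mult_left_mono[OF g2 \<open>A \<ge> 0\<close>] by linarith
  have prod: "torus_int (\<lambda>x. \<bar>g x\<bar>) * torus_int (\<lambda>x. \<bar>h x\<bar>) \<le> c * r * (L + 1) * (2 * X)"
    using g1 h1 nn c(2) lam L by (intro mult_mono) auto
  have gh: "\<bar>conv_form K g h\<bar> \<le> S * (c * r * (L + 1) * (2 * X))" "\<bar>conv_form K h g\<bar> \<le> S * (c * r * (L + 1) * (2 * X))"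
    using conv_form_le_L1[OF intg inth] conv_form_le_L1[OF inth intg] mult_left_mono[OF prod bound_nonneg]
    by (simp_all add: mult_ac)
  have hh: "\<bar>conv_form K h h\<bar> \<le> S * (4 * (L + 1) * r * X)"
  proof -
    have "torus_int (\<lambda>x. \<bar>h x\<bar>) * torus_int (\<lambda>x. \<bar>h x\<bar>) \<le> (2 * X) * (2 * X)"
      using h1 nn by (intro mult_mono) auto
    \<comment> \<open>One factor \<open>X\<close> is traded for \<open>(L + 1) * r\<close>, which
      brings this term to the same shape as the two mixed ones.\<close>
    also have "\<dots> \<le> (2 * X) * (2 * ((L + 1) * r))"
    proof -
      have "X \<le> r * r"
        using X by (simp add: power2_eq_square)
      also have "\<dots> \<le> (L + 1) * r"
        using lam L by (intro mult_right_mono) auto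
      finally show ?thesis
        using \<open>X \<ge> 0\<close> by (intro mult_left_mono) auto
    qed
    finally have "S * (torus_int (\<lambda>x. \<bar>h x\<bar>) * torus_int (\<lambda>x. \<bar>h x\<bar>))
        \<le> S * ((2 * X) * (2 * ((L + 1) * r)))"
      by (rule mult_left_mono[OF _ bound_nonneg])
    also have "\<dots> = S * (4 * (L + 1) * r * X)"
      by simp
    finally show ?thesis
      using conv_form_le_L1[OF inth inth] by (simp add: mult.assoc)
  qed
  have "\<bar>conv_form K \<rho> \<rho> - A * (mass u)^2 / L\<bar> \<le> A * (4 * c^2 * X) + S * (c * r * (L + 1) * (2 * X))
      + S * (c * r * (L + 1) * (2 * X)) + S * (4 * (L + 1) * r * X)"
    unfolding eq using gg gh hh by linarith
  also have "\<dots> = X * (4 * A * c^2 + 4 * S * (L + 1) * r * (c + 1))"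
    by (simp add: algebra_simps)
  finally show ?thesis .
qed

section \<open>Orbital stability\<close>

lemma infsum_split_0:
  fixes f :: "int^'d::finite \<Rightarrow> real"
  assumes "f summable_on UNIV"
  shows "infsum f UNIV = f 0 + infsum f (UNIV - {0})"
proof -
  have "f summable_on (UNIV - {0})"
    by (rule summable_on_subset[OF assms]) simp
  then show ?thesis
    using infsum_insert[of f "UNIV - {0}" 0] by (simp add: insert_absorb)
qed

lemma ivec_sq_nonneg: "ivec_sq m \<ge> 0"
  by (simp add: ivec_sq_def sum_nonneg)

lemma ivec_sq_0: "ivec_sq 0 = 0"
  by (simp add: ivec_sq_def)

lemma ivec_sq_ge_1:
  assumes "m \<noteq> 0"
  shows "ivec_sq m \<ge> 1"
proof -
  obtain i where "m$i \<noteq> 0"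
    using assms by (auto simp: vec_eq_iff)
  then have "0 < (m$i)^2"
    by simp
  also have "\<dots> \<le> ivec_sq m"
    unfolding ivec_sq_def by (rule member_le_sum) auto
  finally show ?thesis
    by simp
qed

lemma in_H1_square_integrable: "in_H1 u \<Longrightarrow> square_integrable u"
  by (simp add: in_H1_def square_integrable_def)

lemma fcoeff_diff_const:
  fixes u :: "real^'d::finite \<Rightarrow> complex" and a :: complex
  assumes u: "square_integrable u"
  shows "fcoeff (\<lambda>x. u x - a) m = fcoeff u m - (if m = 0 then (2 * pi) ^ CARD('d) * a else 0)"
proof -
  have "fcoeff (\<lambda>x. u x - a) m = torus_int (\<lambda>x. u x * cnj (torus_exp m x) - a * torus_exp (- m) x)"
    by (simp add: fcoeff_eq cnj_torus_exp left_diff_distrib)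
  also have "\<dots> = fcoeff u m - a * torus_int (torus_exp (- m) :: real^'d \<Rightarrow> complex)"
  proof -
    have "integrable torus (\<lambda>x. u x * cnj (torus_exp m x))"
      by (rule square_integrable_mult[OF u square_integrable_cnj[OF square_integrable_torus_exp]])
    moreover have "integrable torus (\<lambda>x. a * torus_exp (- m) x)"
      by (intro integrable_mult_right square_integrable_integrable square_integrable_torus_exp)
    ultimately show ?thesis
      unfolding fcoeff_eq torus_int_def by (subst Bochner_Integration.integral_diff) simp_all
  qed
  finally show ?thesis
    by (simp add: torus_int_torus_exp)
qed

lemma H1_norm_nonneg: "H1_norm u \<ge> 0"
  unfolding H1_norm_def
  by (intro real_sqrt_ge_zero divide_nonneg_nonneg infsum_nonneg mult_nonneg_nonneg add_nonneg_nonneg)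
     (simp_all add: ivec_sq_nonneg)

text \<open>Subtracting a constant changes only the zero mode, so the contribution \<open>Y\<close>
  of the nonzero modes is the same for every \<open>a\<close>. On these modes
  \<open>ivec_sq m \<ge> 1\<close>, which compares \<open>Y\<close> with \<open>dirichlet u\<close>
  and, through completeness, gives the Poincare inequality stated first.\<close>

lemma H1_norm_diff_const:
  fixes u :: "real^'d::finite \<Rightarrow> complex"
  defines "L \<equiv> (2 * pi) ^ CARD('d)"
  assumes u: "in_H1 u"
  obtains Y where "mass u - (cmod (fcoeff u 0))^2 / L \<le> dirichlet u" "dirichlet u \<le> Y" "Y \<le> 2 * dirichlet u"
    "\<And>a :: complex. (H1_norm (\<lambda>x. u x - a))^2 = L * (cmod (fcoeff u 0 / L - a))^2 + Y"
proof
  have L: "L > 0"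
    by (simp add: L_def)
  define s where "s m = (cmod (fcoeff u m))^2" for m
  define q where "q m = real_of_int (ivec_sq m)" for m :: "int^'d"
  have q: "q m \<ge> 0" "m \<noteq> 0 \<Longrightarrow> q m \<ge> 1" "q 0 = 0" for m
    using ivec_sq_nonneg[of m] ivec_sq_ge_1[of m] by (simp_all add: q_def ivec_sq_0)
  have s: "s m \<ge> 0" for m
    by (simp add: s_def)
  have sumW: "(\<lambda>m. (1 + q m) * s m) summable_on UNIV"
    using u by (simp add: in_H1_def s_def q_def)
  have sums: "s summable_on UNIV"
    by (rule summable_on_comparison_test[OF sumW]) (use q(1) s in \<open>simp_all add: algebra_simps\<close>)
  have sumq: "(\<lambda>m. q m * s m) summable_on UNIV"
    by (rule summable_on_comparison_test[OF sumW]) (use q(1) s in \<open>simp_all add: algebra_simps\<close>)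
  note sub = summable_on_subset[OF _ subset_UNIV[of "UNIV - {0}"]]
  define Y where "Y = (\<Sum>\<^sub>\<infinity>m\<in>UNIV - {0}. (1 + q m) * s m) / L"
  have D: "dirichlet u = (\<Sum>\<^sub>\<infinity>m\<in>UNIV - {0}. q m * s m) / L"
    using infsum_split_0[OF sumq] q(3) by (simp add: dirichlet_def q_def s_def L_def)
  have le: "(\<Sum>\<^sub>\<infinity>m\<in>UNIV - {0}. s m) \<le> (\<Sum>\<^sub>\<infinity>m\<in>UNIV - {0}. q m * s m)"
    using q(2) s mult_right_mono[of 1 "q _" "s _"] by (intro infsum_mono sub sums sumq) auto
  have "Y = (\<Sum>\<^sub>\<infinity>m\<in>UNIV - {0}. s m) / L + dirichlet u"
    unfolding Y_def D
    by (simp add: distrib_right infsum_add[OF sub[OF sums] sub[OF sumq]] add_divide_distrib)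
  moreover have "0 \<le> (\<Sum>\<^sub>\<infinity>m\<in>UNIV - {0}. s m)"
    by (rule infsum_nonneg) (rule s)
  ultimately show "dirichlet u \<le> Y" "Y \<le> 2 * dirichlet u"
    using le L divide_right_mono[OF le, of L] by (simp_all add: D)
  have "mass u \<le> (s 0 + (\<Sum>\<^sub>\<infinity>m\<in>UNIV - {0}. s m)) / L"
    using mass_le_sum_fcoeff[OF in_H1_square_integrable[OF u]] sums infsum_split_0[OF sums]
    by (simp add: s_def[abs_def] L_def)
  then show "mass u - (cmod (fcoeff u 0))^2 / L \<le> dirichlet u"
    using divide_right_mono[OF le, of L] L by (simp add: D s_def[of 0] add_divide_distrib)
  show "(H1_norm (\<lambda>x. u x - a))^2 = L * (cmod (fcoeff u 0 / L - a))^2 + Y" for a :: complex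
  proof -
    define W where "W m = (1 + q m) * (cmod (fcoeff (\<lambda>x. u x - a) m))^2" for m
    have fc: "fcoeff (\<lambda>x. u x - a) m = fcoeff u m - (if m = 0 then L * a else 0)" for m
      by (simp add: fcoeff_diff_const[OF in_H1_square_integrable[OF u]] L_def)
    have W: "W m = (1 + q m) * s m" if "m \<in> UNIV - {0}" for m
      using that by (simp add: W_def fc s_def)
    \<comment> \<open>Summability is inherited from \<open>u\<close>, since the two series differ
      only in the term at 0; without it the infinite sum could not be split.\<close>
    have "W summable_on (UNIV - {0})"
      by (rule iffD2[OF summable_on_cong[OF W] sub[OF sumW]])
    then have sumW': "W summable_on UNIV"
      using summable_on_insert_iff[of W 0 "UNIV - {0}"] by (simp add: insert_absorb)
    have "W m \<ge> 0" for m
      using q(1)[of m] by (simp add: W_def)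
    then have "(\<Sum>\<^sub>\<infinity>m. W m) / L \<ge> 0"
      using L by (intro divide_nonneg_nonneg infsum_nonneg) auto
    then have "(H1_norm (\<lambda>x. u x - a))^2 = (\<Sum>\<^sub>\<infinity>m. W m) / L"
      by (simp add: H1_norm_def W_def[abs_def] q_def L_def)
    also have "\<dots> = (W 0 + (\<Sum>\<^sub>\<infinity>m\<in>UNIV - {0}. (1 + q m) * s m)) / L"
      using infsum_split_0[OF sumW'] infsum_cong[of "UNIV - {0}" W "\<lambda>m. (1 + q m) * s m"] W by simp
    also have "W 0 = L * L * (cmod (fcoeff u 0 / L - a))^2"
    proof -
      have "fcoeff u 0 - L * a = L * (fcoeff u 0 / L - a)"
        using L by (simp add: field_simps)
      then show ?thesis
        using L by (simp add: W_def fc q norm_mult power_mult_distrib power2_eq_square[of L])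
    qed
    also have "(L * L * (cmod (fcoeff u 0 / L - a))^2 + (\<Sum>\<^sub>\<infinity>m\<in>UNIV - {0}. (1 + q m) * s m)) / L
        = L * (cmod (fcoeff u 0 / L - a))^2 + Y"
      using L by (simp add: Y_def field_simps)
    finally show ?thesis .
  qed
qed

text \<open>Continuity argument. While \<open>X \<le> r\<close>, conservation and the estimate on
  \<open>E\<close> give \<open>\<eta> * D s \<le> 2 * d\<close>, hence \<open>D s < r\<close>. If
  \<open>X\<close> ever exceeded \<open>r\<close>, it would first take the value \<open>r\<close> at
  some time, contradicting \<open>X \<le> D\<close>.\<close>

lemma energy_bootstrap:
  fixes X D E :: "real \<Rightarrow> real"
  assumes contX: "continuous_on {0..} X" and X_le: "\<And>t. t \<ge> 0 \<Longrightarrow> X t \<le> D t"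
    and conserved: "\<And>t. t \<ge> 0 \<Longrightarrow> D t - E t = D 0 - E 0"
    and est: "\<And>t. t \<ge> 0 \<Longrightarrow> X t \<le> r \<Longrightarrow> \<bar>E t\<bar> \<le> (1 - \<eta>) * X t"
    and \<eta>: "0 < \<eta>" "\<eta> \<le> 1" and d: "D 0 \<le> d" "0 \<le> d" "2 * d < \<eta> * r"
    and t: "t \<ge> 0"
  shows "X t \<le> r \<and> D t \<le> 2 * d / \<eta>"
proof -
  \<comment> \<open>This leads to \<open>d < r\<close>, so that the estimate on \<open>E\<close> is
    available at time 0. The two sources \<open>D 0\<close> and \<open>E 0\<close> account for the
    factor 2 in the final bound.\<close>
  have "d * \<eta> \<le> d"
    using \<eta> d(2) mult_left_le by blast
  then have "d * \<eta> \<le> 2 * d"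
    using d(2) by linarith
  also have "\<dots> < r * \<eta>"
    using d(3) by (simp add: mult.commute)
  finally have "d < r"
    using \<eta>(1) by simp
  have dr: "2 * d / \<eta> < r"
    using d(3) \<eta>(1) by (simp add: divide_less_eq mult.commute)
  have X0: "X 0 \<le> D 0" "X 0 < r"
    using X_le[of 0] d(1) \<open>d < r\<close> by auto
  have D_le: "D s \<le> 2 * d / \<eta>" if s: "s \<ge> 0" "X s \<le> r" for s
  proof -
    have "\<bar>E s\<bar> \<le> (1 - \<eta>) * D s" "\<bar>E 0\<bar> \<le> (1 - \<eta>) * d"
      using est[OF s] est[of 0] X0 X_le[OF s(1)] d(1) \<eta>(2) mult_left_mono[of "X s" "D s" "1 - \<eta>"]
        mult_left_mono[of "X 0" d "1 - \<eta>"] by auto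
    moreover have "(1 - \<eta>) * d \<le> d"
      using \<eta> d(2) by (simp add: mult_left_le_one_le)
    ultimately have "\<eta> * D s \<le> 2 * d"
      using conserved[OF s(1)] d(1) by (simp add: algebra_simps)
    then show ?thesis
      using \<eta>(1) by (simp add: le_divide_eq mult.commute)
  qed
  have "X t \<le> r"
  proof (rule ccontr)
    assume "\<not> X t \<le> r"
    moreover have "continuous_on {0..t} X"
      by (rule continuous_on_subset[OF contX]) auto
    ultimately obtain s where s: "0 \<le> s" "s \<le> t" "X s = r"
      using IVT'[of X 0 r t] X0(2) t by auto
    then show False
      using D_le[of s] X_le[of s] dr by auto
  qed
  with D_le[OF t] show ?thesis
    by simp
qed

lemma kappa_of_nonneg: "kappa_of \<sigma> \<ge> 0"
  unfolding kappa_of_def by (intro divide_nonneg_nonneg Bochner_Integration.integral_nonneg) auto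

lemma smooth_fun_continuous:
  assumes "smooth_fun f"
  shows "continuous_on A f"
proof (intro continuous_at_imp_continuous_on ballI)
  fix x
  \<comment> \<open>The empty list of derivatives is \<open>f\<close> itself.\<close>
  have "iter_partial [] f differentiable (at x)"
    using assms unfolding smooth_fun_def by blast
  then show "isCont f x"
    using differentiable_imp_continuous_within by simp
qed

lemma abs_norm_square_diff_1_le:
  fixes w :: complex
  assumes "cmod (w - 1) \<le> \<delta>" "\<delta> \<le> 1"
  shows "\<bar>(cmod w)^2 - 1\<bar> \<le> 3 * \<delta>"
proof -
  have "\<bar>cmod w - 1\<bar> \<le> \<delta>"
    using norm_triangle_ineq3[of w 1] assms(1) by simp
  moreover have "\<bar>cmod w + 1\<bar> \<le> 3"
    using calculation assms(2) by auto
  ultimately have "\<bar>cmod w - 1\<bar> * \<bar>cmod w + 1\<bar> \<le> \<delta> * 3"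
    by (intro mult_mono) auto
  moreover have "(cmod w)^2 - 1 = (cmod w - 1) * (cmod w + 1)"
    by (simp add: power2_eq_square algebra_simps)
  ultimately show ?thesis
    by (simp add: abs_mult)
qed

theorem theorem3p5:
  fixes \<sigma>1 :: "real^'d::finite \<Rightarrow> real"
    and \<sigma>2 :: "real^'n::finite \<Rightarrow> real"
    and \<gamma> \<omega> :: real
    and k :: "int^'d"
  assumes n3: "CARD('n) \<ge> 3"
    and s1_nonneg: "\<forall>x. \<sigma>1 x \<ge> 0"
    and s1_smooth: "smooth_fun \<sigma>1"
    and s1_periodic: "periodic_torus \<sigma>1"
    and s1_radial: "radial_torus \<sigma>1"
    and s1_mean: "torus_int \<sigma>1 \<noteq> 0"
    and s2_nonneg: "\<forall>z. \<sigma>2 z \<ge> 0"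
    and s2_smooth: "smooth_fun \<sigma>2"
    and s2_radial: "\<forall>x y. norm x = norm y \<longrightarrow> \<sigma>2 x = \<sigma>2 y"
    and s2_supp: "bounded {z. \<sigma>2 z \<noteq> 0}"
    and s2_L2: "integrable lborel (\<lambda>\<xi>. (cmod (fourier_Rn \<sigma>2 \<xi>))^2 / (norm \<xi>)^2)"
    and s2_ft: "\<forall>\<xi>. fourier_Rn \<sigma>2 \<xi> \<noteq> 0"
    and \<gamma>_pos: "\<gamma> > 0"
    and disp: "\<omega> + of_int (ivec_sq k) / 2 = \<gamma>^2 * kappa_of \<sigma>2 * (torus_int \<sigma>1)^2"
    and small: "4 * \<gamma>^2 * kappa_of \<sigma>2 * (torus_int (\<lambda>x. \<bar>\<sigma>1 x\<bar>))^2 < 1"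
  shows "\<forall>\<epsilon>>0. \<exists>\<delta>>0. \<forall>vinit. in_H1 vinit \<and> H1_norm (\<lambda>x. vinit x - 1) < \<delta> \<longrightarrow>
           (\<forall>v. is_solution \<sigma>1 \<gamma> (kappa_of \<sigma>2) k v \<and> v 0 = vinit
                \<and> (\<forall>t\<ge>0. mass (v t) = mass (v 0))
                \<and> (\<forall>t\<ge>0. \<forall>j. momentum (v t) j = momentum (v 0) j)
                \<and> (\<forall>t\<ge>0. energy \<sigma>1 \<gamma> (kappa_of \<sigma>2) k (v t) = energy \<sigma>1 \<gamma> (kappa_of \<sigma>2) k (v 0))
              \<longrightarrow> (\<exists>c<\<epsilon>. \<forall>t\<ge>0.
                     (INF \<theta>\<in>{0..<2*pi}. H1_norm (\<lambda>x. v t x - cis \<theta>)) \<le> c))"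
proof (intro allI impI)
  define L :: real where "L = (2 * pi) ^ CARD('d)"
  define A where "A = (torus_int \<sigma>1)^2"
  define b where "b = \<gamma>^2 * kappa_of \<sigma>2"
  have "1 \<le> 2 * pi"
    using pi_gt3 by linarith
  then have L: "L \<ge> 1"
    unfolding L_def by (rule one_le_power)
  have b: "b \<ge> 0"
    by (simp add: b_def kappa_of_nonneg)
  have small': "4 * (b * A) < 1"
    using small s1_nonneg by (simp add: b_def A_def mult.assoc)
  have A: "A \<ge> 0"
    by (simp add: A_def)
  obtain S where kernel: "torus_kernel (Sigma \<sigma>1) S A"
    unfolding A_def using torus_kernel_Sigma[OF smooth_fun_continuous[OF s1_smooth] s1_periodic] s1_nonneg by blast
  interpret torus_kernel "Sigma \<sigma>1" S A
    by (rule kernel)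
  \<comment> \<open>Half of the gap in the smallness condition. The leading coefficient is
    \<open>1 - 2 * \<eta>\<close>; one \<open>\<eta>\<close> absorbs the errors from
    \<open>\<delta>\<close> and \<open>r\<close>, and the other remains as coercivity.\<close>
  define \<eta> where "\<eta> = (1 - 4 * (b * A)) / 2"
  have \<eta>: "\<eta> > 0" "\<eta> \<le> 1 / 2" "4 * (b * A) = 1 - 2 * \<eta>"
    using small' mult_nonneg_nonneg[OF b A] by (simp_all add: \<eta>_def field_simps)
  define C where "C = b * (4 * S * (L + 1))"
  have C: "C \<ge> 0"
    using b bound_nonneg L by (simp add: C_def)
  \<comment> \<open>Chosen so that the higher-order terms cost at most \<open>\<eta> / 2\<close>;
    the 4 in the next estimate bounds \<open>cmod (c t) + 1\<close>.\<close>
  define r where "r = min 1 (\<eta> / (8 * (C + 1)))"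
  have r: "0 < r" "r \<le> 1"
    using \<eta> C by (simp_all add: r_def)
  have Cr: "4 * (C * r) \<le> \<eta> / 2"
  proof -
    have "C * r \<le> (C + 1) * (\<eta> / (8 * (C + 1)))"
      using C r \<eta> by (intro mult_mono) (auto simp: r_def)
    also have "\<dots> = \<eta> / 8"
      using C by (simp add: field_simps)
    finally show ?thesis
      by simp
  qed
  \<comment> \<open>The final distance will be at most \<open>\<delta> * R\<close>: the first
    summand comes from the error in the modulus of the mean, the second from the nonzero
    modes.\<close>
  define R where "R = sqrt (L * (4 + 2 / \<eta>)^2 + 4 / \<eta>)"
  have R: "R > 0" "R^2 = L * (4 + 2 / \<eta>)^2 + 4 / \<eta>"
  proof -
    have "L * (4 + 2 / \<eta>)^2 + 4 / \<eta> > 0"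
      using L \<eta> by (intro add_nonneg_pos) auto
    then show "R > 0" "R^2 = L * (4 + 2 / \<eta>)^2 + 4 / \<eta>"
      by (simp_all add: R_def)
  qed
  fix \<epsilon> :: real assume \<epsilon>: "\<epsilon> > 0"
  \<comment> \<open>The first bound starts the bootstrap and controls the mass, the second makes the
    final distance at most \<open>\<epsilon> / 2\<close>.\<close>
  define \<delta> where "\<delta> = min (\<eta> * r / 8) (\<epsilon> / (2 * R))"
  have \<delta>: "\<delta> > 0" "\<delta> \<le> \<eta> * r / 8" "\<delta> * R \<le> \<epsilon> / 2"
  proof -
    show "\<delta> > 0" "\<delta> \<le> \<eta> * r / 8"
      using \<eta> r \<epsilon> R by (simp_all add: \<delta>_def)
    have "\<delta> * R \<le> \<epsilon> / (2 * R) * R"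
      using R by (intro mult_right_mono) (simp_all add: \<delta>_def)
    then show "\<delta> * R \<le> \<epsilon> / 2"
      using R by simp
  qed
  have \<delta>': "\<delta> \<le> \<eta> / 8" "\<delta> \<le> 1" "2 * \<delta>^2 < \<eta> * r^2"
  proof -
    have "\<eta> * r \<le> \<eta>" "\<eta> * r \<le> r"
      using \<eta> r by (simp_all add: mult_left_le mult_left_le_one_le)
    then show "\<delta> \<le> \<eta> / 8" "\<delta> \<le> 1"
      using \<delta>(2) \<eta>(2) by linarith+
    have "\<delta>^2 \<le> (\<eta> * r / 8) * (r / 8)"
    proof -
      have "\<delta> \<le> r / 8"
        using \<delta>(2) \<open>\<eta> * r \<le> r\<close> by linarith
      then show ?thesis
        unfolding power2_eq_square using \<delta>(1,2) by (intro mult_mono) auto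
    qed
    also have "\<dots> = \<eta> * r^2 / 64"
      by (simp add: power2_eq_square)
    finally show "2 * \<delta>^2 < \<eta> * r^2"
      using mult_pos_pos[OF \<eta>(1), of "r^2"] r by simp
  qed
  show "\<exists>\<delta>>0. \<forall>vinit. in_H1 vinit \<and> H1_norm (\<lambda>x. vinit x - 1) < \<delta> \<longrightarrow>
           (\<forall>v. is_solution \<sigma>1 \<gamma> (kappa_of \<sigma>2) k v \<and> v 0 = vinit
                \<and> (\<forall>t\<ge>0. mass (v t) = mass (v 0))
                \<and> (\<forall>t\<ge>0. \<forall>j. momentum (v t) j = momentum (v 0) j)
                \<and> (\<forall>t\<ge>0. energy \<sigma>1 \<gamma> (kappa_of \<sigma>2) k (v t) = energy \<sigma>1 \<gamma> (kappa_of \<sigma>2) k (v 0))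
              \<longrightarrow> (\<exists>c<\<epsilon>. \<forall>t\<ge>0.
                     (INF \<theta>\<in>{0..<2*pi}. H1_norm (\<lambda>x. v t x - cis \<theta>)) \<le> c))"
  proof (rule exI[of _ \<delta>], rule conjI[OF \<delta>(1)], intro allI impI, elim conjE)
    fix vinit v
    assume vinit: "H1_norm (\<lambda>x. vinit x - 1) < \<delta>"
      and sol: "is_solution \<sigma>1 \<gamma> (kappa_of \<sigma>2) k v" and v0: "v 0 = vinit"
      and mass: "\<forall>t\<ge>0. mass (v t) = mass (v 0)"
      and mom: "\<forall>t\<ge>0. \<forall>j. momentum (v t) j = momentum (v 0) j"
      and energy: "\<forall>t\<ge>0. energy \<sigma>1 \<gamma> (kappa_of \<sigma>2) k (v t) = energy \<sigma>1 \<gamma> (kappa_of \<sigma>2) k (v 0)"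
    define M where "M = mass (v 0)"
    define c where "c t = fcoeff (v t) 0 / L" for t
    define X where "X t = M - (cmod (fcoeff (v t) 0))^2 / L" for t
    define D where "D t = dirichlet (v t)" for t
    define Q where "Q t = conv_form (Sigma \<sigma>1) (\<lambda>x. (cmod (v t x))^2) (\<lambda>x. (cmod (v t x))^2)" for t
    \<comment> \<open>The interaction is measured relative to that of a uniform density with the
      same mass. As the mass is conserved this subtracts a constant, and it makes \<open>E\<close>
      small of order \<open>X\<close>.\<close>
    define E where "E t = b * (Q t - A * M^2 / L)" for t
    have M: "mass (v t) = M" if "t \<ge> 0" for t
      using mass that unfolding M_def by blast
    have H1: "in_H1 (v t)" if "t \<ge> 0" for t
      using sol that by (simp add: is_solution_def)
    have "\<exists>Y. X t \<le> D t \<and> D t \<le> Y \<and> Y \<le> 2 * D t \<and>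
        (\<forall>a. (H1_norm (\<lambda>x. v t x - a))^2 = L * (cmod (c t - a))^2 + Y)" if "t \<ge> 0" for t
      using H1_norm_diff_const[OF H1[OF that]] unfolding X_def D_def c_def L_def M[OF that, symmetric] by metis
    then obtain Y where XD: "\<And>t. t \<ge> 0 \<Longrightarrow> X t \<le> D t" and Y: "\<And>t. t \<ge> 0 \<Longrightarrow> D t \<le> Y t" "\<And>t. t \<ge> 0 \<Longrightarrow> Y t \<le> 2 * D t"
      and H1_norm: "\<And>t a. t \<ge> 0 \<Longrightarrow> (H1_norm (\<lambda>x. v t x - a))^2 = L * (cmod (c t - a))^2 + Y t"
      by metis
    have X_nonneg: "X t \<ge> 0" if "t \<ge> 0" for t
      using mass_fluctuation[OF in_H1_square_integrable[OF H1[OF that]]] mass_nonneg M[OF that]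
      unfolding X_def L_def by metis
    \<comment> \<open>The modulus of the mean is determined by the conserved mass and the
      fluctuation \<open>X\<close>.\<close>
    have mod_c: "(cmod (c t))^2 = (M - X t) / L" for t
      using L by (simp add: X_def c_def norm_divide power_divide power2_eq_square)
    have init: "L * (cmod (c 0 - 1))^2 + Y 0 < \<delta>^2"
      using vinit power_strict_mono[OF _ H1_norm_nonneg, of "\<lambda>x. vinit x - 1" \<delta> 2] H1_norm[of 0 1]
      by (simp add: v0)
    have "0 \<le> L * (cmod (c 0 - 1))^2"
      using L by simp
    then have D0: "D 0 \<le> \<delta>^2"
      using init Y(1)[of 0] by linarith
    have "(cmod (c 0 - 1))^2 \<le> L * (cmod (c 0 - 1))^2"
      using L by (simp add: mult_le_cancel_right1)
    also have "\<dots> \<le> \<delta>^2"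
      using init Y(1)[of 0] XD[of 0] X_nonneg[of 0] by linarith
    finally have "cmod (c 0 - 1) \<le> \<delta>"
      using \<delta>(1) power2_le_imp_le by fastforce
    from abs_norm_square_diff_1_le[OF this \<delta>'(2)]
    have "\<bar>(M - X 0) / L - 1\<bar> \<le> 3 * \<delta>"
      by (simp add: mod_c)
    moreover have "0 \<le> X 0 / L" "X 0 / L \<le> \<delta>"
    proof -
      have "X 0 / L \<le> X 0"
        using L X_nonneg[of 0] by (simp add: divide_le_eq mult_le_cancel_left1)
      also have "\<dots> \<le> \<delta> * \<delta>"
        using XD[of 0] D0 by (simp add: power2_eq_square)
      also have "\<dots> \<le> \<delta>"
        using \<delta> \<delta>'(2) by (simp add: mult_left_le)
      finally show "X 0 / L \<le> \<delta>" .
    qed (use L X_nonneg[of 0] in simp)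
    \<comment> \<open>\<open>3 * \<delta>\<close> comes from the mean at time 0 and one more
      \<open>\<delta>\<close> from the initial fluctuation.\<close>
    ultimately have M1: "\<bar>M / L - 1\<bar> \<le> 4 * \<delta>"
      by (simp add: diff_divide_distrib)
    have c_le: "(cmod (c t))^2 \<le> 1 + 4 * \<delta>" if "t \<ge> 0" for t
    proof -
      have "0 \<le> X t / L"
        using X_nonneg[OF that] L by simp
      then show ?thesis
        using M1 unfolding mod_c diff_divide_distrib by linarith
    qed
    have est: "\<bar>E t\<bar> \<le> (1 - \<eta>) * X t" if t: "t \<ge> 0" "X t \<le> r^2" for t
    proof -
      have "cmod (c t) \<le> 3"
        using c_le[OF t(1)] \<delta>'(2) power2_le_imp_le[of "cmod (c t)" 3] by simp
      have "\<bar>Q t - A * M^2 / L\<bar> \<le> X t * (4 * A * (cmod (c t))^2 + 4 * S * (L + 1) * r * (cmod (c t) + 1))"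
        using conv_form_density_bound[OF in_H1_square_integrable[OF H1[OF t(1)]] r] t(2)
        unfolding Q_def X_def c_def L_def M[OF t(1)] by simp
      then have "\<bar>E t\<bar> \<le> b * (X t * (4 * A * (cmod (c t))^2 + 4 * S * (L + 1) * r * (cmod (c t) + 1)))"
        using b by (simp add: E_def abs_mult mult_left_mono)
      also have "\<dots> = X t * (4 * (b * A) * (cmod (c t))^2 + C * r * (cmod (c t) + 1))"
        by (simp add: C_def algebra_simps)
      also have "\<dots> \<le> X t * (1 - \<eta>)"
      proof (rule mult_left_mono[OF _ X_nonneg[OF t(1)]])
        have "4 * (b * A) * (cmod (c t))^2 \<le> 4 * (b * A) * (1 + 4 * \<delta>)"
          using b A c_le[OF t(1)] by (intro mult_left_mono) auto
        \<comment> \<open>Since \<open>4 * (b * A) < 1\<close>, the deviation of the mean from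
          modulus 1 costs at most \<open>4 * \<delta>\<close>, hence at most
          \<open>\<eta> / 2\<close>.\<close>
        also have "\<dots> \<le> 4 * (b * A) + 4 * \<delta>"
          using mult_right_mono[of "4 * (b * A)" 1 "4 * \<delta>"] small' \<delta>(1) by (simp add: distrib_left)
        finally have "4 * (b * A) * (cmod (c t))^2 \<le> 1 - 2 * \<eta> + \<eta> / 2"
          using \<eta>(3) \<delta>'(1) by linarith
        moreover have "C * r * (cmod (c t) + 1) \<le> C * r * 4"
          using C r \<open>cmod (c t) \<le> 3\<close> by (intro mult_left_mono) auto
        ultimately show "4 * (b * A) * (cmod (c t))^2 + C * r * (cmod (c t) + 1) \<le> 1 - \<eta>"
          using Cr by linarith
      qed
      finally show ?thesis
        by (simp add: mult.commute)
    qed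
    \<comment> \<open>Up to the factor 4 this is the energy after removing its mass and momentum
      terms, which are constant in time.\<close>
    have conserved: "D t - E t = D 0 - E 0" if "t \<ge> 0" for t
    proof -
      define P where "P = momentum (v 0)"
      have energy_eq: "energy \<sigma>1 \<gamma> (kappa_of \<sigma>2) k (v s) = D s / 4 + (of_int (ivec_sq k) / 4) * M
          + (\<Sum>j\<in>UNIV. of_int (k$j) * P j) / 2 - b / 4 * Q s" if "s \<ge> 0" for s
      proof -
        have "momentum (v s) j = P j" for j
          using mom that unfolding P_def by blast
        then show ?thesis
          by (simp add: energy_def M[OF that] D_def b_def Q_def conv_form_def potential_def field_simps)
      qed
      have "energy \<sigma>1 \<gamma> (kappa_of \<sigma>2) k (v t) = energy \<sigma>1 \<gamma> (kappa_of \<sigma>2) k (v 0)"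
        using energy that by blast
      then have "D t / 4 - b / 4 * Q t = D 0 / 4 - b / 4 * Q 0"
        unfolding energy_eq[OF that] energy_eq[of 0, OF order_refl] by linarith
      then show ?thesis
        by (simp add: E_def algebra_simps)
    qed
    \<comment> \<open>Differentiability of the zero Fourier coefficient in time, which
      \<open>is_solution\<close> includes, gives the continuity of \<open>X\<close>.\<close>
    have "continuous_on {0..} (\<lambda>t. fcoeff (v t) 0)"
      unfolding continuous_on_eq_continuous_within
    proof
      fix t :: real assume "t \<in> {0..}"
      then obtain F where "((\<lambda>s. fcoeff (v s) 0) has_vector_derivative F) (at t within {0..})"
        using sol unfolding is_solution_def by force
      then show "continuous (at t within {0..}) (\<lambda>s. fcoeff (v s) 0)"
        by (rule has_vector_derivative_continuous)
    qed
    then have contX: "continuous_on {0..} X"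
      unfolding X_def by (intro continuous_intros) (use L in auto)
    \<comment> \<open>The phase is the argument of the mean \<open>c t\<close>, so the distance of
      \<open>c t\<close> to the circle point is just the error in its modulus.\<close>
    have main: "H1_norm (\<lambda>x. v t x - cis (Arg2pi (c t))) \<le> \<epsilon> / 2" if t: "t \<ge> 0" for t
    proof -
      \<comment> \<open>The bootstrap runs with threshold \<open>r^2\<close> and initial size
        \<open>\<delta>^2\<close>.\<close>
      have Dt: "D t \<le> 2 * \<delta>^2 / \<eta>"
        using energy_bootstrap[OF contX XD conserved est \<eta>(1) _ D0 _ \<delta>'(3) t] \<eta>(2) by auto
      have "c t - cis (Arg2pi (c t)) = of_real (cmod (c t) - 1) * cis (Arg2pi (c t))"
        using Arg2pi_eq[of "c t"] by (simp add: cis_conv_exp algebra_simps)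
      then have "cmod (c t - cis (Arg2pi (c t))) = \<bar>cmod (c t) - 1\<bar>"
        by (simp only: norm_mult norm_of_real norm_cis mult_1_right)
      also have "\<dots> \<le> \<bar>(cmod (c t))^2 - 1\<bar>"
      proof -
        have "(cmod (c t))^2 - 1 = (cmod (c t) - 1) * (cmod (c t) + 1)"
          by (simp add: power2_eq_square algebra_simps)
        then show ?thesis
          by (simp add: abs_mult mult_le_cancel_left1)
      qed
      \<comment> \<open>The first term is the mass deviation \<open>M1\<close>, the second the
        fluctuation \<open>X t / L\<close> bounded by the bootstrap.\<close>
      also have "\<dots> \<le> 4 * \<delta> + 2 / \<eta> * \<delta>"
      proof -
        have "X t / L \<le> X t"
          using L X_nonneg[OF t] by (simp add: divide_le_eq mult_le_cancel_left1)
        also have "\<dots> \<le> 2 * \<delta>^2 / \<eta>"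
          using XD[OF t] Dt by linarith
        also have "\<dots> \<le> 2 / \<eta> * \<delta>"
          using \<delta> \<delta>'(2) \<eta>(1) by (simp add: power2_eq_square divide_right_mono mult_left_le)
        finally have "X t / L \<le> 2 / \<eta> * \<delta>" .
        moreover have "0 \<le> X t / L"
          using X_nonneg[OF t] L by simp
        ultimately show ?thesis
          using M1 unfolding mod_c diff_divide_distrib by linarith
      qed
      finally have "(cmod (c t - cis (Arg2pi (c t))))^2 \<le> ((4 + 2 / \<eta>) * \<delta>)^2"
        by (intro power_mono) (simp_all add: distrib_right)
      then have "L * (cmod (c t - cis (Arg2pi (c t))))^2 \<le> L * ((4 + 2 / \<eta>)^2 * \<delta>^2)"
        using L by (simp add: power_mult_distrib)
      moreover have "Y t \<le> 4 / \<eta> * \<delta>^2"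
        using Y(2)[OF t] Dt by simp
      ultimately have "(H1_norm (\<lambda>x. v t x - cis (Arg2pi (c t))))^2 \<le> (\<delta> * R)^2"
        unfolding H1_norm[OF t] power_mult_distrib R(2) by (simp add: algebra_simps)
      then have "H1_norm (\<lambda>x. v t x - cis (Arg2pi (c t))) \<le> \<delta> * R"
        using \<delta>(1) R(1) power2_le_imp_le[of _ "\<delta> * R"] by (simp add: less_imp_le)
      then show ?thesis
        using \<delta>(3) by linarith
    qed
    show "\<exists>c<\<epsilon>. \<forall>t\<ge>0. (INF \<theta>\<in>{0..<2*pi}. H1_norm (\<lambda>x. v t x - cis \<theta>)) \<le> c"
    \<comment> \<open>A bound \<open>\<epsilon> / 2\<close> uniform in time yields the strict
      inequality for the supremum.\<close>
    proof (intro exI[of _ "\<epsilon> / 2"] conjI allI impI)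
      fix t :: real assume t: "t \<ge> 0"
      have "(INF \<theta>\<in>{0..<2*pi}. H1_norm (\<lambda>x. v t x - cis \<theta>)) \<le> H1_norm (\<lambda>x. v t x - cis (Arg2pi (c t)))"
        using Arg2pi[of "c t"] by (intro cINF_lower bdd_belowI[of _ 0]) (auto simp: H1_norm_nonneg)
      then show "(INF \<theta>\<in>{0..<2*pi}. H1_norm (\<lambda>x. v t x - cis \<theta>)) \<le> \<epsilon> / 2"
        using main[OF t] by linarith
    qed (use \<epsilon> in simp)
  qed
qed

end
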